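(* Let $(X,Y,\mu)$ be an integrable $(G,H)$-transverse system. (i) For every $F\in\mathcal L^\infty_c(G\times Y)$ the $Y$-periodization $TF(x)=\sum_{Hg\in Y_x}\int_H F((hg)^{-1},hg.x)\,dm_H(h)$ is $\mu$-integrable. (ii) There exists a unique finite $H$-invariant Borel measure $\sigma$ on $Y$ such that for all $F\in\mathcal L^\infty_c(G\times Y)$ and all $\phi\in\mathcal L^\infty(X,\mu)$ $$\int_X TF(x)\,\overline{\phi(x)}\,d\mu(x)=\int_G\int_Y F(g,y)\,\overline{\phi(g.y)}\,d\sigma(y)\,dm_G(g).$$
   Context: $G$ is a unimodular locally compact second countable (lcsc) group and $H<G$ a closed unimodular subgroup, with fixed Haar measures $m_G,m_H$ and projection $\pi:G\to H\backslash G$. $X$ is a standard Borel $G$-space. A $(G,H)$-cross section is a Borel subset $Y\subset X$ with $G.Y=X$ and $H.Y=Y$; its hitting time sets are $Y_x=\{Hg\in H\backslash G\mid g.x\in Y\}$, $x\in X$. If $\mu$ is a $G$-invariant Borel probability measure on $X$, then $(X,Y,\mu)$ is a $(G,H)$-transverse system; it is integrable if $\int_X|Y_x\cap L|\,d\mu(x)<\infty$ for every compact $L\subset H\backslash G$. $\mathcal L^\infty_c(G\times Y)$ is the space of bounded Borel functions $G\times Y\to\mathbb C$ vanishing outside $L\times Y$ for some compact $L\subset G$. $\mathcal L^\infty(X,\mu)$ denotes bounded Borel functions on $X$. *)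

theory Defs
  imports "HOL-Analysis.Analysis" "HOL-Probability.Probability_Measure"
begin

text \<open>
  Groups are types of class \<open>topological_group_add\<close>, which is written additively but does not
  assume commutativity: \<open>g + h\<close> is the product \<open>gh\<close>, \<open>- g\<close> is \<open>g\<inverse>\<close> and \<open>0\<close> is the identity.
\<close>

definition add_subgroup :: "'g::group_add set \<Rightarrow> bool" where
  "add_subgroup S \<longleftrightarrow> 0 \<in> S \<and> (\<forall>g\<in>S. \<forall>h\<in>S. g + h \<in> S) \<and> (\<forall>g\<in>S. - g \<in> S)"

text \<open>
  Left Haar measures on a closed subgroup \<open>S\<close> (\<open>S = UNIV\<close> for the whole group), as measures with
  carrier \<open>S\<close>. Regularity is not listed: on a second countable locally compact group it follows from
  finiteness on compact sets.
\<close>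

definition haar_measure :: "'g::topological_group_add set \<Rightarrow> 'g measure \<Rightarrow> bool" where
  "haar_measure S m \<longleftrightarrow>
     sets m = sets (restrict_space borel S) \<and>
     (\<forall>g\<in>S. distr m m (\<lambda>x. g + x) = m) \<and>
     (\<forall>K. compact K \<and> K \<subseteq> S \<longrightarrow> emeasure m K < \<infinity>) \<and>
     emeasure m S \<noteq> 0"

definition unimodular :: "'g::topological_group_add set \<Rightarrow> bool" where
  "unimodular S \<longleftrightarrow> (\<forall>m. haar_measure S m \<longrightarrow> (\<forall>g\<in>S. distr m m (\<lambda>x. x + g) = m))"

text \<open>The coset \<open>Hg\<close>, and the space \<open>H\G\<close> of these cosets with the quotient topology.\<close>

definition rcoset :: "'g::group_add set \<Rightarrow> 'g \<Rightarrow> 'g set" where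
  "rcoset H g = (\<lambda>h. h + g) ` H"

definition coset_space :: "'g::topological_group_add set \<Rightarrow> 'g set topology" where
  "coset_space H = topology (\<lambda>U. U \<subseteq> range (rcoset H) \<and> open (rcoset H -` U))"

lemma openin_coset_space:
  "openin (coset_space H) U \<longleftrightarrow> U \<subseteq> range (rcoset H) \<and> open (rcoset H -` U)"
proof -
  have "istopology (\<lambda>U. U \<subseteq> range (rcoset H) \<and> open (rcoset H -` U))"
    unfolding istopology_def by (auto simp: vimage_Union)
  then show ?thesis
    unfolding coset_space_def by (simp add: topology_inverse')
qed

lemma topspace_coset_space: "topspace (coset_space H) = range (rcoset H)"
proof -
  have "openin (coset_space H) (range (rcoset H))"
    by (simp add: openin_coset_space vimage_def)
  then show ?thesis
    unfolding topspace_def using openin_coset_space by blast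
qed

definition standard_borel :: "'x measure \<Rightarrow> bool" where
  "standard_borel X \<longleftrightarrow>
     (\<exists>T. completely_metrizable_space T \<and> second_countable T \<and> topspace T = space X \<and>
          sets X = sigma_sets (space X) {U. openin T U})"

definition standard_borel_G_space ::
  "'x measure \<Rightarrow> ('g::topological_group_add \<Rightarrow> 'x \<Rightarrow> 'x) \<Rightarrow> bool" where
  "standard_borel_G_space X act \<longleftrightarrow>
     standard_borel X \<and>
     (\<lambda>(g, x). act g x) \<in> borel \<Otimes>\<^sub>M X \<rightarrow>\<^sub>M X \<and>
     (\<forall>x\<in>space X. act 0 x = x) \<and>
     (\<forall>g h. \<forall>x\<in>space X. act (g + h) x = act g (act h x))"

definition cross_section ::
  "'g set \<Rightarrow> 'x measure \<Rightarrow> ('g::topological_group_add \<Rightarrow> 'x \<Rightarrow> 'x) \<Rightarrow> 'x set \<Rightarrow> bool" where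
  "cross_section H X act Y \<longleftrightarrow>
     Y \<in> sets X \<and>
     (\<Union>g. act g ` Y) = space X \<and>
     (\<Union>h\<in>H. act h ` Y) = Y"

definition hitting ::
  "'g::group_add set \<Rightarrow> ('g \<Rightarrow> 'x \<Rightarrow> 'x) \<Rightarrow> 'x set \<Rightarrow> 'x \<Rightarrow> 'g set set" where
  "hitting H act Y x = {rcoset H g | g. act g x \<in> Y}"

definition transverse_system ::
  "'g set \<Rightarrow> 'x measure \<Rightarrow> ('g::topological_group_add \<Rightarrow> 'x \<Rightarrow> 'x) \<Rightarrow> 'x set \<Rightarrow> 'x measure \<Rightarrow> bool" where
  "transverse_system H X act Y \<mu> \<longleftrightarrow>
     standard_borel_G_space X act \<and>
     cross_section H X act Y \<and>
     sets \<mu> = sets X \<and> prob_space \<mu> \<and> (\<forall>g. distr \<mu> \<mu> (act g) = \<mu>)"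

text \<open>
  The integrand below need only be universally measurable. This does no harm: by
  \<open>nn_integral_completion\<close> the integral is also the one for the completion of \<open>\<mu>\<close>.
  The counting measure is used instead of \<open>card\<close> because \<open>card\<close> is \<open>0\<close> on infinite sets.
\<close>

definition integrable_transverse_system ::
  "'g set \<Rightarrow> 'x measure \<Rightarrow> ('g::topological_group_add \<Rightarrow> 'x \<Rightarrow> 'x) \<Rightarrow> 'x set \<Rightarrow> 'x measure \<Rightarrow> bool" where
  "integrable_transverse_system H X act Y \<mu> \<longleftrightarrow>
     transverse_system H X act Y \<mu> \<and>
     (\<forall>L. compactin (coset_space H) L \<longrightarrow>
        (\<integral>\<^sup>+x. emeasure (count_space UNIV) (hitting H act Y x \<inter> L) \<partial>\<mu>) < \<infinity>)"

text \<open>Bounded Borel functions on the whole space, and on \<open>G \<times> Y\<close> with support condition over \<open>G\<close>;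
  values of \<open>F\<close> outside \<open>G \<times> Y\<close> are unconstrained and play no role.\<close>

definition Linf :: "'x measure \<Rightarrow> ('x \<Rightarrow> complex) set" where
  "Linf X = {\<phi> \<in> borel_measurable X. \<exists>C. \<forall>x\<in>space X. norm (\<phi> x) \<le> C}"

definition Linf_c ::
  "'x measure \<Rightarrow> 'x set \<Rightarrow> ('g::topological_space \<times> 'x \<Rightarrow> complex) set" where
  "Linf_c X Y = {F \<in> borel_measurable (borel \<Otimes>\<^sub>M restrict_space X Y).
     (\<exists>C. \<forall>g. \<forall>y\<in>Y. norm (F (g, y)) \<le> C) \<and>
     (\<exists>L. compact L \<and> (\<forall>g y. g \<notin> L \<and> y \<in> Y \<longrightarrow> F (g, y) = 0))}"

text \<open>
  The summand does not depend on the chosen representative of the coset when \<open>mH\<close> is right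
  invariant.
\<close>

definition coset_rep :: "'g set \<Rightarrow> 'g" where
  "coset_rep C = (SOME g. g \<in> C)"

definition periodization ::
  "'g::group_add set \<Rightarrow> 'g measure \<Rightarrow> ('g \<Rightarrow> 'x \<Rightarrow> 'x) \<Rightarrow> 'x set \<Rightarrow> ('g \<times> 'x \<Rightarrow> complex) \<Rightarrow> 'x \<Rightarrow> complex" where
  "periodization H mH act Y F x =
     (\<Sum>\<^sub>\<infinity>C\<in>hitting H act Y x.
        \<integral>h. F (- (h + coset_rep C), act (h + coset_rep C) x) \<partial>mH)"

end

theory Submission
  imports Defs
begin

text \<open>
  For \<open>F \<ge> 0\<close> the map \<open>F \<mapsto> \<integral> TF d\<mu>\<close> is a measure \<open>\<nu>\<close> on \<open>G \<times> X\<close> carried by \<open>G \<times> Y\<close>. Replacing \<open>F\<close> by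
  \<open>(g, y) \<mapsto> F (a g, y)\<close> replaces \<open>TF\<close> by \<open>x \<mapsto> TF (a.x)\<close>, so \<open>\<nu>\<close> is left invariant in \<open>G\<close>; by uniqueness of
  Haar measure \<open>\<nu> = m\<^sub>G \<otimes> \<sigma>\<close>. Since \<open>T\<close> multiplies by \<open>\<phi>\<close> when \<open>F\<close> is multiplied by \<open>(g, y) \<mapsto> \<phi> (g.y)\<close>,
  the case \<open>\<phi> = 1\<close> suffices. If \<open>F\<close> vanishes off \<open>K \<times> Y\<close> with \<open>K\<close> compact, then \<open>|TF x|\<close> is at most a constant
  times the number of points of \<open>Y\<^sub>x\<close> in the image of \<open>K\<^sup>-\<^sup>1\<close>, which gives integrability.

  The delicate point is that \<open>TF\<close> is measurable for the completion of \<open>\<mu>\<close>. Counting the points of \<open>Y\<^sub>x\<close> in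
  ever finer finite partitions of the coset space reduces this to the measurability of projections of Borel
  subsets of \<open>G \<times> X\<close>, which follows from Choquet's capacitability theorem.
\<close>

section \<open>Projections of measurable sets\<close>

text \<open>The invariance hypotheses have separate tasks. Right invariance of \<open>mH\<close>,
  that is unimodularity of \<open>H\<close>, makes the inner integral independent of the
  representative of a coset; left invariance of \<open>mH\<close> makes \<open>\<sigma>\<close>
  invariant under \<open>H\<close>. Unimodularity of \<open>G\<close> makes the left invariant
  measure \<open>E \<mapsto> \<nu> (E \<times> A)\<close> right invariant as well, so that one
  application of Fubini compares it with \<open>mG\<close> and no modular function appears. That
  computation also dictates the normalization: \<open>\<sigma> A\<close> is the value of
  \<open>\<nu>\<close> on \<open>- K \<times> A\<close> divided by \<open>mG K\<close>, for one
  fixed compact \<open>K\<close> of positive finite measure. In the capacity argument compactness is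
  needed only in the factor \<open>G\<close> that is projected away. A second obstacle comes from
  the default value 0 of divergent sums and integrals: additivity of the complex periodization can
  fail at a bad point. For support over a compact \<open>K\<close> it is therefore shown only where
  finitely many cosets of the hitting set meet the set of inverses of \<open>K\<close>, which is
  almost everywhere.\<close>

lemma list_extension_choice:
  assumes "Q []" and "\<And>l. Q l \<Longrightarrow> \<exists>j. Q (l @ [j])"
  shows "\<exists>m. \<forall>n. Q (map m [0..<n])"
proof -
  \<comment> \<open>Dependent choice is applied to a chain of lists, each extending the previous one
    by a single entry; the appended entries form the desired sequence.\<close>
  obtain f where f: "\<And>n. length (f n) = n \<and> Q (f n)" "\<And>n. \<exists>j. f (Suc n) = f n @ [j]"
    using dependent_nat_choice[of "\<lambda>n l. length l = n \<and> Q l" "\<lambda>n l l'. \<exists>j. l' = l @ [j]"] assms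
    by (metis length_append_singleton list.size(3))
  obtain m where m: "\<And>n. f (Suc n) = f n @ [m n]"
    using f(2) by metis
  have "f n = map m [0..<n]" for n
    by (induction n) (use f(1)[of 0] m in auto)
  then show ?thesis
    using f(1) by metis
qed

section \<open>Suslin schemes and Choquet's capacitability theorem\<close>

text \<open>
  The set at stage \<open>n\<close> is indexed by a whole sequence \<open>a\<close>, but depends only on \<open>a 0, \<dots>, a n\<close>; this is
  the usual scheme indexed by finite sequences.
\<close>

definition suslin_scheme :: "'a set set \<Rightarrow> (nat \<Rightarrow> (nat \<Rightarrow> nat) \<Rightarrow> 'a set) \<Rightarrow> bool" where
  "suslin_scheme \<P> P \<longleftrightarrow> (\<forall>n a. P n a \<in> \<P>) \<and> (\<forall>n a b. (\<forall>i\<le>n. a i = b i) \<longrightarrow> P n a = P n b)"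

definition suslin :: "'a set set \<Rightarrow> 'a set \<Rightarrow> bool" where
  "suslin \<P> B \<longleftrightarrow> (\<exists>P. suslin_scheme \<P> P \<and> B = {z. \<exists>a. \<forall>n. z \<in> P n a})"

lemma suslin_schemeD:
  assumes "suslin_scheme \<P> P"
  shows "P n a \<in> \<P>" and "(\<And>i. i \<le> n \<Longrightarrow> a i = b i) \<Longrightarrow> P n a = P n b"
  using assms unfolding suslin_scheme_def by blast+

lemma suslinI:
  fixes P :: "nat \<Rightarrow> (nat \<Rightarrow> nat) \<Rightarrow> 'a set"
  assumes "\<And>n a. P n a \<in> \<P>"
    and "\<And>n a b. (\<And>i. i \<le> n \<Longrightarrow> a i = b i) \<Longrightarrow> P n a = P n b"
    and "B = {z. \<exists>a. \<forall>n. z \<in> P n a}"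
  shows "suslin \<P> B"
proof -
  have "suslin_scheme \<P> P"
    unfolding suslin_scheme_def using assms(1,2) by blast
  with assms(3) show ?thesis unfolding suslin_def by blast
qed

lemma suslin_base: "A \<in> \<P> \<Longrightarrow> suslin \<P> A"
  by (rule suslinI[of "\<lambda>_ _. A"]) auto

lemma suslin_UN:
  fixes B :: "nat \<Rightarrow> 'a set"
  assumes "\<And>i. suslin \<P> (B i)"
  shows "suslin \<P> (\<Union>i. B i)"
proof -
  have "\<forall>i. \<exists>P. suslin_scheme \<P> P \<and> B i = {z. \<exists>a. \<forall>n. z \<in> P n a}"
    using assms unfolding suslin_def by blast
  then obtain P where scheme: "\<And>i. suslin_scheme \<P> (P i)"
    and B_eq: "\<And>i. B i = {z. \<exists>a. \<forall>n. z \<in> P i n a}"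
    by metis
  note P_mem = suslin_schemeD(1)[OF scheme]
  note P_cong = suslin_schemeD(2)[OF scheme]
  \<comment> \<open>The entry \<open>a 0\<close> codes a pair: the index of the set and the true
    first entry. Since everything extra sits in coordinate 0, stage \<open>n\<close> still depends
    only on the entries up to \<open>n\<close>.\<close>
  define d where "d a = (\<lambda>j. if j = 0 then snd (prod_decode (a 0)) else a j)" for a :: "nat \<Rightarrow> nat"
  show ?thesis
  proof (rule suslinI[of "\<lambda>n a. P (fst (prod_decode (a 0))) n (d a)"])
    show "P (fst (prod_decode (a 0))) n (d a) = P (fst (prod_decode (b 0))) n (d b)"
      if "\<And>i. i \<le> n \<Longrightarrow> a i = b i" for n a b
    proof -
      have "d a j = d b j" if "j \<le> n" for j
        using \<open>\<And>i. i \<le> n \<Longrightarrow> a i = b i\<close>[of 0] \<open>\<And>i. i \<le> n \<Longrightarrow> a i = b i\<close>[of j] that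
        by (simp add: d_def)
      then show ?thesis
        using that[of 0] by (simp add: P_cong[of n "d a" "d b"])
    qed
    have "\<exists>a. \<forall>n. z \<in> P (fst (prod_decode (a 0))) n (d a)" if "\<forall>n. z \<in> P i n a" for z i a
    proof -
      let ?c = "a(0 := prod_encode (i, a 0))"
      have "d ?c = a" by (auto simp: d_def)
      then show ?thesis using that by (intro exI[of _ ?c]) auto
    qed
    then show "(\<Union>i. B i) = {z. \<exists>a. \<forall>n. z \<in> P (fst (prod_decode (a 0))) n (d a)}"
      by (auto simp: B_eq)
  qed (rule P_mem)
qed

lemma suslin_INT:
  fixes B :: "nat \<Rightarrow> 'a set"
  assumes "\<And>i. suslin \<P> (B i)"
  shows "suslin \<P> (\<Inter>i. B i)"
proof -
  have "\<forall>i. \<exists>P. suslin_scheme \<P> P \<and> B i = {z. \<exists>a. \<forall>n. z \<in> P n a}"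
    using assms unfolding suslin_def by blast
  then obtain P where scheme: "\<And>i. suslin_scheme \<P> (P i)"
    and B_eq: "\<And>i. B i = {z. \<exists>a. \<forall>n. z \<in> P i n a}"
    by metis
  note P_mem = suslin_schemeD(1)[OF scheme]
  note P_cong = suslin_schemeD(2)[OF scheme]
  \<comment> \<open>One sequence codes a witness for every \<open>B i\<close>: its entries at the
    positions \<open>prod_encode (i, k)\<close> form the witness for \<open>B i\<close>, and stage
    \<open>prod_encode (i, j)\<close> tests stage \<open>j\<close> of that scheme.\<close>
  define Q where "Q n a = (case prod_decode n of (i, j) \<Rightarrow> P i j (\<lambda>k. a (prod_encode (i, k))))"
    for n and a :: "nat \<Rightarrow> nat"
  \<comment> \<open>Stage \<open>n = prod_encode (i, j)\<close> reads the positions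
    \<open>prod_encode (i, k)\<close> with \<open>k \<le> j\<close>; monotonicity keeps all of them
    at most \<open>n\<close>, as a scheme requires.\<close>
  have mono: "prod_encode (i, k) \<le> prod_encode (i, j)" if "k \<le> j" for i j k
  proof -
    have "triangle (i + k) \<le> triangle (i + j)"
      unfolding triangle_def using that by (intro div_le_mono mult_le_mono) auto
    then show ?thesis by (simp add: prod_encode_def)
  qed
  show ?thesis
  proof (rule suslinI[of Q])
    show "Q n a \<in> \<P>" for n a by (simp add: Q_def P_mem split: prod.split)
    show "Q n a = Q n b" if "\<And>i. i \<le> n \<Longrightarrow> a i = b i" for n a b
    proof -
      obtain i j where ij: "prod_decode n = (i, j)" by force
      then have "n = prod_encode (i, j)" by (metis prod_decode_inverse)
      then show ?thesis
        unfolding Q_def ij prod.case using that mono by (intro P_cong) blast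
    qed
    have "z \<in> (\<Inter>i. B i) \<longleftrightarrow> (\<exists>a. \<forall>n. z \<in> Q n a)" for z
    proof
      assume "z \<in> (\<Inter>i. B i)"
      then obtain a where a: "\<And>i n. z \<in> P i n (a i)" by (auto simp: B_eq) metis
      have "z \<in> Q n (\<lambda>m. case prod_decode m of (i, j) \<Rightarrow> a i j)" for n
        using a by (simp add: Q_def split: prod.split)
      then show "\<exists>a. \<forall>n. z \<in> Q n a" by blast
    next
      assume "\<exists>a. \<forall>n. z \<in> Q n a"
      then obtain a where a: "\<And>n. z \<in> Q n a" by blast
      have "z \<in> P i j (\<lambda>k. a (prod_encode (i, k)))" for i j
        using a[of "prod_encode (i, j)"] by (simp add: Q_def)
      then show "z \<in> (\<Inter>i. B i)" by (auto simp: B_eq)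
    qed
    then show "(\<Inter>i. B i) = {z. \<exists>a. \<forall>n. z \<in> Q n a}" by blast
  qed
qed

lemma suslin_Un:
  assumes "suslin \<P> A" "suslin \<P> B"
  shows "suslin \<P> (A \<union> B)"
proof -
  have "suslin \<P> (\<Union>i::nat. if i = 0 then A else B)"
    using assms by (intro suslin_UN) auto
  also have "(\<Union>i::nat. if i = 0 then A else B) = A \<union> B"
    by (auto split: if_splits)
  finally show ?thesis .
qed

text \<open>Continuity from below permits bounding the entries of the witnesses one coordinate at a
  time while the capacity stays above \<open>t\<close>. Once all entries are bounded by a sequence
  \<open>m\<close>, only finitely many prefixes of each length remain, so stage \<open>k\<close>
  becomes a finite union of sets of the paving, and Koenig's lemma puts the intersection of all
  stages inside \<open>B\<close>. Continuity from below is asked only inside \<open>B\<close>, where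
  the outer measure used later is known to have it. The passage to the limit along \<open>C\<close>
  is left to the application.\<close>

lemma Choquet_capacitability:
  fixes I :: "'a set \<Rightarrow> ennreal"
  assumes "suslin \<P> B"
    and Int: "\<And>A C. A \<in> \<P> \<Longrightarrow> C \<in> \<P> \<Longrightarrow> A \<inter> C \<in> \<P>"
    and Un: "\<And>A C. A \<in> \<P> \<Longrightarrow> C \<in> \<P> \<Longrightarrow> A \<union> C \<in> \<P>"
    and mono: "\<And>A C. A \<subseteq> C \<Longrightarrow> I A \<le> I C"
    and cont: "\<And>A. incseq A \<Longrightarrow> (\<And>n. A n \<subseteq> B) \<Longrightarrow> I (\<Union>n::nat. A n) = (SUP n. I (A n))"
    and t: "t < I B"
  obtains C :: "nat \<Rightarrow> 'a set" where "\<And>n. C n \<in> \<P>" "decseq C" "(\<Inter>n. C n) \<subseteq> B" "\<And>n. t < I (C n)"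
proof -
  obtain P where scheme: "suslin_scheme \<P> P" and B_eq: "B = {z. \<exists>a. \<forall>n. z \<in> P n a}"
    using \<open>suslin \<P> B\<close> unfolding suslin_def by blast
  note P_mem = suslin_schemeD(1)[OF scheme]
  note P_cong = suslin_schemeD(2)[OF scheme]
  \<comment> \<open>\<open>D l\<close> collects the points of \<open>B\<close> with a witness whose
    first entries are bounded by \<open>l\<close>. Appending a bound \<open>j\<close> and letting
    \<open>j\<close> grow exhausts \<open>D l\<close>, which is where continuity from below
    acts.\<close>
  define D where "D l = {z. \<exists>a. (\<forall>i<length l. a i \<le> l ! i) \<and> (\<forall>n. z \<in> P n a)}" for l
  have "\<exists>m. \<forall>n. t < I (D (map m [0..<n]))"
  proof (rule list_extension_choice)
    show "t < I (D [])" using t by (simp add: D_def B_eq)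
    fix l assume l: "t < I (D l)"
    have "I (\<Union>j. D (l @ [j])) = (SUP j. I (D (l @ [j])))"
    proof (rule cont)
      show "incseq (\<lambda>j. D (l @ [j]))"
      proof (rule incseq_SucI)
        fix j
        have "(l @ [j]) ! i \<le> (l @ [Suc j]) ! i" if "i < Suc (length l)" for i
          using that by (auto simp: nth_append less_Suc_eq)
        then have "\<forall>i<Suc (length l). a i \<le> (l @ [Suc j]) ! i"
          if "\<forall>i<Suc (length l). a i \<le> (l @ [j]) ! i" for a :: "nat \<Rightarrow> nat"
          using that order_trans by blast
        then show "D (l @ [j]) \<subseteq> D (l @ [Suc j])"
          unfolding D_def by auto
      qed
    qed (auto simp: D_def B_eq)
    moreover have "D l \<subseteq> (\<Union>j. D (l @ [j]))"
    proof
      fix z assume "z \<in> D l"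
      then obtain a where "(\<forall>i<length l. a i \<le> l ! i) \<and> (\<forall>n. z \<in> P n a)"
        by (auto simp: D_def)
      then have "z \<in> D (l @ [a (length l)])"
        by (auto simp: D_def nth_append less_Suc_eq intro!: exI[of _ a])
      then show "z \<in> (\<Union>j. D (l @ [j]))" by blast
    qed
    ultimately have "t < (SUP j. I (D (l @ [j])))"
      using l mono by (metis less_le_trans)
    then show "\<exists>j. t < I (D (l @ [j]))" by (simp add: less_SUP_iff)
  qed
  then obtain m where m: "\<And>n. t < I (D (map m [0..<n]))" by blast
  \<comment> \<open>Stages up to \<open>k\<close> do not see the entries after \<open>k\<close>.
    Replacing these by 0 leaves the finite set \<open>F k\<close> of bounded prefixes, so that
    \<open>C k\<close> is a finite union of finite intersections.\<close>
  define tr where "tr k a = (\<lambda>i. if i \<le> k then a i else 0)" for k :: nat and a :: "nat \<Rightarrow> nat"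
  have P_tr: "P n (tr k a) = P n a" if "n \<le> k" for n k a
    using that by (intro P_cong) (auto simp: tr_def)
  define F where "F k = {a. (\<forall>i\<le>k. a i \<le> m i) \<and> (\<forall>i>k. a i = 0)}" for k
  have fin: "finite (F k)" for k
  proof (rule finite_subset)
    show "F k \<subseteq> {f. \<forall>x. (x \<in> {..k} \<longrightarrow> f x \<in> {..Max (m ` {..k})}) \<and> (x \<notin> {..k} \<longrightarrow> f x = 0)}"
      by (auto simp: F_def Max_ge_iff)
  qed (intro finite_set_of_finite_funs; simp)
  have "(\<lambda>_. 0) \<in> F k" for k by (auto simp: F_def)
  define C where "C k = (\<Union>a\<in>F k. \<Inter>n\<in>{..k}. P n a)" for k
  have C_iff: "z \<in> C k \<longleftrightarrow> (\<exists>a. (\<forall>i\<le>k. a i \<le> m i) \<and> (\<forall>n\<le>k. z \<in> P n a))" for z k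
  proof
    assume "\<exists>a. (\<forall>i\<le>k. a i \<le> m i) \<and> (\<forall>n\<le>k. z \<in> P n a)"
    then obtain a where a: "\<forall>i\<le>k. a i \<le> m i" "\<forall>n\<le>k. z \<in> P n a" by blast
    then have "tr k a \<in> F k" by (auto simp: F_def tr_def)
    moreover have "\<forall>n\<le>k. z \<in> P n (tr k a)" using a(2) P_tr by auto
    ultimately show "z \<in> C k" unfolding C_def by (auto intro!: bexI[of _ "tr k a"])
  qed (auto simp: C_def F_def)
  show thesis
  proof
    show "C k \<in> \<P>" for k
    proof -
      have INT: "(\<Inter>n\<in>{..j}. P n a) \<in> \<P>" for j a
        by (induction j) (auto simp: atMost_Suc P_mem Int)
      have "S \<noteq> {} \<Longrightarrow> (\<Union>a\<in>S. \<Inter>n\<in>{..k}. P n a) \<in> \<P>" if "finite S" for S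
        using that
      proof (induction S rule: finite_induct)
        case (insert a S)
        then show ?case by (cases "S = {}") (auto simp: INT intro!: Un simp del: INT_simps)
      qed auto
      then show ?thesis
        unfolding C_def using fin \<open>(\<lambda>_. 0) \<in> F k\<close> by blast
    qed
    show "decseq C"
    proof (rule decseq_SucI)
      show "C (Suc n) \<subseteq> C n" for n
        unfolding subset_iff C_iff by (meson le_SucI)
    qed
    show "t < I (C n)" for n
    proof -
      \<comment> \<open>A list of length \<open>Suc n\<close> bounds the entries 0 to
        \<open>n\<close>, exactly those that \<open>C n\<close> constrains.\<close>
      have "D (map m [0..<Suc n]) \<subseteq> C n"
      proof
        fix z assume "z \<in> D (map m [0..<Suc n])"
        then obtain a where "\<forall>i<Suc n. a i \<le> m i" "\<forall>n. z \<in> P n a"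
          by (auto simp: D_def simp del: upt_Suc)
        then show "z \<in> C n" by (auto simp: C_iff intro!: exI[of _ a])
      qed
      with m[of "Suc n"] mono show ?thesis by (metis less_le_trans)
    qed
    show "(\<Inter>n. C n) \<subseteq> B"
    proof
      fix z assume z: "z \<in> (\<Inter>n. C n)"
      \<comment> \<open>Koenig's lemma for the tree of prefixes bounded by \<open>m\<close>:
        \<open>R l k a\<close> says that \<open>a\<close> continues \<open>l\<close> and witnesses
        \<open>z\<close> up to depth \<open>k\<close>. A prefix is kept if it can be continued to
        every depth, where the continuation may vary with the depth.\<close>
      define R where "R l k a \<longleftrightarrow> (\<forall>i<length l. a i = l ! i) \<and> (\<forall>i\<le>k. a i \<le> m i) \<and> (\<forall>n\<le>k. z \<in> P n a)"
        for l k a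
      have "\<exists>a. \<forall>n. \<forall>k. \<exists>b. R (map a [0..<n]) k b"
      proof (rule list_extension_choice)
        show "\<forall>k. \<exists>b. R [] k b" using z by (auto simp: R_def C_iff)
        fix l assume l: "\<forall>k. \<exists>b. R l k b"
        show "\<exists>j. \<forall>k. \<exists>b. R (l @ [j]) k b"
        proof (rule ccontr)
          assume "\<not> ?thesis"
          then obtain f where f: "\<And>j b. \<not> R (l @ [j]) (f j) b" by metis
          \<comment> \<open>If every \<open>j\<close> failed as the next entry, each would fail at
            some depth \<open>f j\<close>. Only finitely many \<open>j\<close> respect the bound
            \<open>m\<close>, and a witness of depth \<open>N\<close> beats all their failing
            depths. Including \<open>length l\<close> ensures that the next entry of this witness is
            bounded by \<open>m\<close>.\<close>
          define N where "N = Max (insert (length l) (f ` {..m (length l)}))"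
          obtain b where b: "R l N b" using l by blast
          have "length l \<le> N" by (auto simp: N_def)
          then have "b (length l) \<le> m (length l)" using b by (auto simp: R_def)
          then have "f (b (length l)) \<le> N" unfolding N_def by (intro Max_ge) auto
          then have "R (l @ [b (length l)]) (f (b (length l))) b"
            using b by (auto simp: R_def nth_append less_Suc_eq)
          with f show False by blast
        qed
      qed
      then obtain a where a: "\<And>n k. \<exists>b. R (map a [0..<n]) k b" by blast
      have "z \<in> P n a" for n
      proof -
        obtain b where b: "R (map a [0..<Suc n]) n b" using a by blast
        then have "P n b = P n a" by (intro P_cong) (auto simp: R_def simp del: upt_Suc)
        then show ?thesis using b by (auto simp: R_def)
      qed
      then show "z \<in> B" by (auto simp: B_eq)
    qed
  qed
qed

section \<open>Finite unions of compact rectangles and the measurable projection theorem\<close>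

inductive_set compact_rectangles :: "'b measure \<Rightarrow> ('a::topological_space \<times> 'b) set set"
  for M :: "'b measure" where
  rectangle: "compact K \<Longrightarrow> A \<in> sets M \<Longrightarrow> K \<times> A \<in> compact_rectangles M"
| union: "P \<in> compact_rectangles M \<Longrightarrow> Q \<in> compact_rectangles M \<Longrightarrow> P \<union> Q \<in> compact_rectangles M"

lemma compact_rectangles_Int:
  fixes P Q :: "('a::t2_space \<times> 'b) set"
  assumes "P \<in> compact_rectangles M" "Q \<in> compact_rectangles M"
  shows "P \<inter> Q \<in> compact_rectangles M"
  using assms
proof (induction P rule: compact_rectangles.induct)
  case (rectangle K A)
  from rectangle.prems rectangle.hyps show ?case
  proof (induction Q rule: compact_rectangles.induct)
    case (rectangle K' A')
    then show ?case
      by (auto simp: Times_Int_Times intro!: compact_rectangles.rectangle compact_Int)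
  qed (auto simp: Int_Un_distrib intro!: compact_rectangles.union)
qed (auto simp: Int_Un_distrib2 intro!: compact_rectangles.union)

text \<open>Compactness of the sections is what lets projection commute with decreasing
  intersections in \<open>measurable_projection\<close>.\<close>

lemma compact_rectangles_section:
  assumes "P \<in> compact_rectangles M"
  shows "compact {g. (g, x) \<in> P}"
  using assms
proof (induction P rule: compact_rectangles.induct)
  case (rectangle K A)
  then show ?case by (cases "x \<in> A") auto
next
  case (union P Q)
  have "{g. (g, x) \<in> P \<union> Q} = {g. (g, x) \<in> P} \<union> {g. (g, x) \<in> Q}" by auto
  with union show ?case by (simp add: compact_Un)
qed

lemma compact_rectangles_projection:
  assumes "P \<in> compact_rectangles M"
  shows "snd ` P \<in> sets M"
  using assms
proof (induction P rule: compact_rectangles.induct)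
  case (rectangle K A)
  then show ?case by (cases "K = {}") auto
qed (auto simp: image_Un)

text \<open>Around each point of \<open>U\<close> some basic open set lies in a compact subset of
  \<open>U\<close>. Only countably many basic sets are of this kind, and one compact set is chosen
  for each. With \<open>U = UNIV\<close> this gives the compact exhaustion of the group.\<close>

lemma open_eq_countable_Union_compact:
  fixes U :: "'a::{second_countable_topology, t2_space} set"
  assumes lc: "locally_compact_space (euclidean :: 'a topology)" and "open U"
  obtains K :: "nat \<Rightarrow> 'a set" where "\<And>n. compact (K n)" "U = (\<Union>n. K n)"
proof -
  have "Hausdorff_space (euclidean :: 'a topology)"
    unfolding Hausdorff_space_def disjnt_def using hausdorff by (simp; blast)
  then have "neighbourhood_base_of (compactin euclidean) (euclidean :: 'a topology)"
    using lc locally_compact_space_neighbourhood_base[of "euclidean :: 'a topology"] by auto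
  then have nb: "\<exists>V K. open V \<and> compact K \<and> x \<in> V \<and> V \<subseteq> K \<and> K \<subseteq> U" if "x \<in> U" for x
    using that \<open>open U\<close> unfolding neighbourhood_base_of by (simp add: compactin_euclidean_iff)
  obtain B :: "'a set set" where B: "countable B" "topological_basis B"
    using ex_countable_basis by blast
  define B' where "B' = {b \<in> B. \<exists>K. compact K \<and> b \<subseteq> K \<and> K \<subseteq> U}"
  have "\<forall>b\<in>B'. \<exists>K. compact K \<and> b \<subseteq> K \<and> K \<subseteq> U"
    by (auto simp: B'_def)
  then obtain k where k: "\<And>b. b \<in> B' \<Longrightarrow> compact (k b) \<and> b \<subseteq> k b \<and> k b \<subseteq> U"
    by metis
  have U: "x \<in> (\<Union>b\<in>B'. k b)" if "x \<in> U" for x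
  proof -
    obtain V K where V: "open V" "compact K" "x \<in> V" "V \<subseteq> K" "K \<subseteq> U"
      using nb[OF \<open>x \<in> U\<close>] by blast
    obtain b where "b \<in> B" "x \<in> b" "b \<subseteq> V"
      using topological_basisE[OF B(2) V(1,3)] by blast
    with V have "b \<in> B'" by (auto simp: B'_def)
    with k \<open>x \<in> b\<close> show ?thesis by blast
  qed
  have "countable B'" using B(1) by (auto simp: B'_def)
  define K where "K n = (if B' = {} then {} else k (from_nat_into B' n))" for n
  show thesis
  proof
    show "compact (K n)" for n
      using k from_nat_into[of B' n] by (auto simp: K_def)
    show "U = (\<Union>n. K n)"
    proof (cases "B' = {}")
      case False
      have "(\<Union>n. K n) = (\<Union>b\<in>range (from_nat_into B'). k b)"
        using False by (auto simp: K_def)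
      also have "\<dots> = (\<Union>b\<in>B'. k b)"
        using False \<open>countable B'\<close> by (simp add: range_from_nat_into)
      also have "\<dots> = U" using U k by blast
      finally show ?thesis by simp
    qed (use U in \<open>auto simp: K_def\<close>)
  qed
qed

text \<open>Suslin sets need not be closed under complement, so the induction carries a set together
  with its complement; countable unions and intersections then exchange roles. This happens twice:
  for the Borel side of a rectangle, and for the product sigma-algebra. The starting point is that
  open and closed subsets of the group are both countable unions of compact sets.\<close>

lemma suslin_pair_measure:
  fixes B :: "('a::{second_countable_topology, t2_space} \<times> 'b) set"
  assumes lc: "locally_compact_space (euclidean :: 'a topology)"
    and "B \<in> sets (borel \<Otimes>\<^sub>M M)"
  shows "suslin (compact_rectangles M) B"
proof -
  let ?S = "suslin (compact_rectangles M) :: ('a \<times> 'b) set \<Rightarrow> bool"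
  have open_S: "?S (U \<times> A) \<and> ?S ((- U) \<times> A)" if "open U" "A \<in> sets M" for U A
  proof -
    obtain K :: "nat \<Rightarrow> 'a set" where K: "\<And>n. compact (K n)" "U = (\<Union>n. K n)"
      using open_eq_countable_Union_compact[OF lc \<open>open U\<close>] by blast
    obtain L :: "nat \<Rightarrow> 'a set" where L: "\<And>n. compact (L n)" "UNIV = (\<Union>n. L n)"
      using open_eq_countable_Union_compact[OF lc open_UNIV] by blast
    have "?S (\<Union>n. K n \<times> A)" "?S (\<Union>n. (L n \<inter> - U) \<times> A)"
      using K(1) L(1) that
      by (intro suslin_UN suslin_base compact_rectangles.rectangle compact_Int_closed; auto)+
    moreover have "(\<Union>n. K n \<times> A) = U \<times> A" "(\<Union>n. (L n \<inter> - U) \<times> A) = (- U) \<times> A"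
      using K(2) L(2) by auto
    ultimately show ?thesis by simp
  qed
  have borel_S: "?S (a \<times> A) \<and> ?S ((- a) \<times> A)" if "a \<in> sets borel" "A \<in> sets M" for a A
  proof -
    have "a \<in> sigma_sets UNIV (Collect open)"
      using that(1) by (simp add: borel_def)
    then show ?thesis
    proof (induction a rule: sigma_sets.induct)
      case (Basic a)
      then show ?case using open_S that by blast
    next
      case Empty
      then show ?case using open_S[OF open_empty that(2)] .
    next
      case (Compl a)
      then show ?case by (simp add: Compl_eq_Diff_UNIV[symmetric])
    next
      case (Union a)
      have "?S (\<Union>i. a i \<times> A)" "?S (\<Inter>i. (- a i) \<times> A)"
        using Union by (auto intro!: suslin_UN suslin_INT)
      moreover have "(\<Union>i. a i \<times> A) = (\<Union>i. a i) \<times> A" "(\<Inter>i. (- a i) \<times> A) = (- (\<Union>i. a i)) \<times> A"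
        by auto
      ultimately show ?case by simp
    qed
  qed
  have "B \<in> sigma_sets (UNIV \<times> space M) {a \<times> b |a b. a \<in> sets borel \<and> b \<in> sets M}"
    using assms(2) by (simp add: sets_pair_measure)
  then have "?S B \<and> ?S (UNIV \<times> space M - B)"
  proof (induction B rule: sigma_sets.induct)
    case (Basic B)
    then obtain a b where ab: "B = a \<times> b" "a \<in> sets borel" "b \<in> sets M" by blast
    have "?S ((- a) \<times> space M \<union> UNIV \<times> (space M - b))"
      using ab borel_S by (intro suslin_Un) auto
    moreover have "(- a) \<times> space M \<union> UNIV \<times> (space M - b) = UNIV \<times> space M - B"
      using ab by auto
    ultimately show ?case using borel_S ab by simp
  next
    case Empty
    show ?case
      using borel_S[of "{}" "{}"] borel_S[of UNIV "space M"] by simp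
  next
    case (Compl a)
    have "a \<subseteq> UNIV \<times> space M"
      using Compl(1) sigma_sets_into_sp[of "{a \<times> b |a b. a \<in> sets borel \<and> b \<in> sets M}" "UNIV \<times> space M"]
        sets.sets_into_space by blast
    then show ?case using Compl by (simp add: double_diff)
  next
    case (Union a)
    have "UNIV \<times> space M - (\<Union>i. a i) = (\<Inter>i. UNIV \<times> space M - a i)" by auto
    moreover have "?S (\<Union>i. a i)"
      using Union.IH by (intro suslin_UN) blast
    moreover have "?S (\<Inter>i. UNIV \<times> space M - a i)"
      using Union.IH by (intro suslin_INT) blast
    ultimately show ?case by (simp only: simp_thms)
  qed
  then show ?thesis by blast
qed

text \<open>The capacity is the outer measure of the projection. Choquet's theorem gives measurable
  subsets of the projection whose measure comes arbitrarily close to that of a measurable hull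
  \<open>E\<close>; a countable union of them has the same measure as \<open>E\<close>, and a set
  between two measurable sets of equal finite measure belongs to the completion.\<close>

theorem measurable_projection:
  fixes B :: "('a::{second_countable_topology, t2_space} \<times> 'b) set"
  assumes lc: "locally_compact_space (euclidean :: 'a topology)"
    and "finite_measure M" and B: "B \<in> sets (borel \<Otimes>\<^sub>M M)"
  shows "snd ` B \<in> sets (completion M)"
proof -
  interpret finite_measure M by fact
  let ?A = "snd ` B"
  define I where "I S = outer_measure_of M (snd ` S)" for S :: "('a \<times> 'b) set"
  have mono: "I S \<le> I T" if "S \<subseteq> T" for S T
    unfolding I_def using that by (intro outer_measure_of_mono image_mono)
  have "B \<subseteq> UNIV \<times> space M"
    using sets.sets_into_space[OF B] by (simp add: space_pair_measure)
  then have A: "?A \<subseteq> space M" by auto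
  obtain E where E: "E \<in> sets M" "?A \<subseteq> E" "outer_measure_of M ?A = emeasure M E"
    using outer_measure_of_attain[OF A] by blast
  have inner: "\<exists>D\<in>sets M. D \<subseteq> ?A \<and> t \<le> emeasure M D" if "t < emeasure M E" for t
  proof -
    have "t < I B" using that E by (simp add: I_def)
    moreover have "I (\<Union>n. S n) = (SUP n. I (S n))" if "incseq S" "\<And>n. S n \<subseteq> B"
      for S :: "nat \<Rightarrow> _"
    proof -
      have "incseq (\<lambda>n. snd ` S n)" using that(1) by (auto simp: incseq_def)
      moreover have "snd ` S n \<subseteq> space M" for n using that(2) A by blast
      ultimately show ?thesis
        by (simp add: I_def image_UN SUP_outer_measure_of_incseq)
    qed
    ultimately obtain C where C: "\<And>n. C n \<in> compact_rectangles M" "decseq C" "(\<Inter>n. C n) \<subseteq> B"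
      "\<And>n. t < I (C n)"
      using Choquet_capacitability[OF suslin_pair_measure[OF lc B], where I = I and t = t,
          OF compact_rectangles_Int compact_rectangles.union mono]
      by blast
    note sets = compact_rectangles_projection[OF C(1)]
    \<comment> \<open>Over a point \<open>x\<close> of every projection the sections of the
      \<open>C n\<close> are compact, nested and nonempty, so by the finite intersection property
      they share a point \<open>g\<close>, and \<open>(g, x)\<close> lies in all
      \<open>C n\<close>.\<close>
    have "(\<Inter>n. snd ` C n) \<subseteq> snd ` (\<Inter>n. C n)"
    proof
      fix x assume x: "x \<in> (\<Inter>n. snd ` C n)"
      note compact = compact_rectangles_section[OF C(1)]
      have "{g. (g, x) \<in> C 0} \<inter> (\<Inter>n\<in>UNIV. {g. (g, x) \<in> C n}) \<noteq> {}"
      proof (rule compact_imp_fip_image[OF compact compact_imp_closed[OF compact]])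
        fix I :: "nat set" assume "finite I"
        then have "n \<le> Max (insert 0 I)" if "n \<in> insert 0 I" for n
          using that by (intro Max_ge) auto
        then have "C (Max (insert 0 I)) \<subseteq> C 0 \<inter> (\<Inter>n\<in>I. C n)"
          using decseqD[OF C(2)] by blast
        moreover obtain g where "(g, x) \<in> C (Max (insert 0 I))" using x by force
        ultimately show "{g. (g, x) \<in> C 0} \<inter> (\<Inter>n\<in>I. {g. (g, x) \<in> C n}) \<noteq> {}" by blast
      qed
      then show "x \<in> snd ` (\<Inter>n. C n)" by force
    qed
    with C(3) have "(\<Inter>n. snd ` C n) \<subseteq> ?A" by blast
    moreover have "t \<le> emeasure M (\<Inter>n. snd ` C n)"
    proof -
      have "emeasure M (\<Inter>n. snd ` C n) = (INF n. emeasure M (snd ` C n))"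
        using C(2) sets by (intro INF_emeasure_decseq[symmetric]) (auto simp: decseq_def)
      moreover have "t \<le> emeasure M (snd ` C n)" for n
        using C(4)[of n] sets[of n] by (simp add: I_def less_imp_le)
      ultimately show ?thesis
        by (auto intro!: INF_greatest)
    qed
    ultimately show ?thesis using sets by (intro bexI[of _ "\<Inter>n. snd ` C n"]) auto
  qed
  \<comment> \<open>Countably many thresholds \<open>t n\<close> with supremum
    \<open>emeasure M E\<close> suffice. Measure 0 is separate because no threshold lies below
    it.\<close>
  have "\<exists>D\<in>sets M. D \<subseteq> ?A \<and> emeasure M D = emeasure M E"
  proof (cases "emeasure M E = 0")
    case True
    then show ?thesis by (intro bexI[of _ "{}"]) auto
  next
    case False
    have "Sup {..<emeasure M E} = emeasure M E"
    proof (rule antisym)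
      show "emeasure M E \<le> Sup {..<emeasure M E}"
        by (rule dense_le) (auto intro: Sup_upper)
    qed (auto intro!: Sup_least less_imp_le)
    moreover have "0 \<in> {..<emeasure M E}"
      using False by (simp add: zero_less_iff_neq_zero)
    ultimately obtain t :: "nat \<Rightarrow> ennreal"
      where t_sub: "range t \<subseteq> {..<emeasure M E}" and t_SUP: "(SUP n. t n) = emeasure M E"
      using ennreal_Sup_countable_SUP[of "{..<emeasure M E}"] by (metis empty_iff)
    have "\<exists>D\<in>sets M. D \<subseteq> ?A \<and> t n \<le> emeasure M D" for n
      using t_sub by (intro inner) auto
    then obtain D where D: "\<And>n. D n \<in> sets M" "\<And>n. D n \<subseteq> ?A" "\<And>n. t n \<le> emeasure M (D n)"
      by metis
    have "emeasure M E \<le> emeasure M (\<Union>n. D n)"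
      unfolding t_SUP[symmetric]
      using D by (intro SUP_least order_trans[OF D(3)] emeasure_mono) auto
    moreover have "emeasure M (\<Union>n. D n) \<le> emeasure M E"
      using D(2) E(1,2) by (intro emeasure_mono) blast+
    ultimately show ?thesis
      using D by (intro bexI[of _ "\<Union>n. D n"]) (auto intro: antisym)
  qed
  then obtain D where D: "D \<in> sets M" "D \<subseteq> ?A" "emeasure M D = emeasure M E" by blast
  show ?thesis
  proof (rule completion.complete_sets_sandwich)
    show "D \<in> sets (completion M)" "E \<in> sets (completion M)"
      using D(1) E(1) by (simp_all add: sets_completionI_sets)
    show "emeasure (completion M) D = emeasure (completion M) E"
      using D E(1) by simp
    show "emeasure (completion M) D < \<infinity>"
      using D(1) by (simp add: less_top[symmetric])
  qed (fact D(2) E(2))+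
qed

section \<open>Haar measures and cosets\<close>

lemma compact_plus:
  fixes A B :: "'a::topological_monoid_add set"
  assumes "compact A" "compact B"
  shows "compact ((\<lambda>(a, b). a + b) ` (A \<times> B))"
  unfolding split_beta
  using assms by (intro compact_continuous_image compact_Times continuous_intros)

lemma compact_uminus:
  fixes A :: "'a::topological_group_add set"
  assumes "compact A"
  shows "compact (uminus ` A)"
  using assms by (intro compact_continuous_image continuous_intros)

text \<open>A compact exhaustion of the closed set writes the sum as a countable union of compact
  sets. Applied to \<open>H\<close> and \<open>K\<close>, it shows that the union of the cosets
  meeting \<open>K\<close> is Borel.\<close>

lemma closed_plus_compact_borel:
  fixes A B :: "'a::{topological_monoid_add, second_countable_topology, t2_space} set"
  assumes lc: "locally_compact_space (euclidean :: 'a topology)" and "closed A" "compact B"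
  shows "(\<lambda>(a, b). a + b) ` (A \<times> B) \<in> sets borel"
proof -
  obtain L :: "nat \<Rightarrow> 'a set" where L: "\<And>n. compact (L n)" "UNIV = (\<Union>n. L n)"
    using open_eq_countable_Union_compact[OF lc open_UNIV] by blast
  have "compact (L n \<inter> A)" for n
    using L(1) assms(2) by (rule compact_Int_closed)
  then have "(\<lambda>(a, b). a + b) ` ((L n \<inter> A) \<times> B) \<in> sets borel" for n
    using assms(3) by (intro borel_closed compact_imp_closed compact_plus)
  then have "(\<Union>n. (\<lambda>(a, b). a + b) ` ((L n \<inter> A) \<times> B)) \<in> sets borel"
    by auto
  moreover have "(\<Union>n. (L n \<inter> A) \<times> B) = A \<times> B"
    using L(2) by blast
  ultimately show ?thesis
    by (simp only: image_UN[symmetric])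
qed

lemma haar_measure_sets_UNIV: "haar_measure UNIV m \<Longrightarrow> sets m = sets borel"
  by (simp add: haar_measure_def)

lemma haar_measure_space: "haar_measure S m \<Longrightarrow> space m = S"
  using sets_eq_imp_space_eq[of m "restrict_space borel S"]
  by (simp add: haar_measure_def space_restrict_space)

lemma haar_measure_sigma_finite:
  fixes S :: "'g::{topological_group_add, second_countable_topology, t2_space} set"
  assumes lc: "locally_compact_space (euclidean :: 'g topology)"
    and S: "closed S" and m: "haar_measure S m"
  shows "sigma_finite_measure m"
proof -
  obtain L :: "nat \<Rightarrow> 'g set" where L: "\<And>n. compact (L n)" "UNIV = (\<Union>n. L n)"
    using open_eq_countable_Union_compact[OF lc open_UNIV] by blast
  have "compact (L n \<inter> S)" for n
    using L(1) S by (rule compact_Int_closed)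
  then have "emeasure m (L n \<inter> S) < \<infinity>" for n
    using m by (auto simp: haar_measure_def)
  then have "emeasure m (L n \<inter> S) \<noteq> \<infinity>" for n
    by (rule less_imp_neq)
  then have fin: "\<forall>a\<in>range (\<lambda>n. L n \<inter> S). emeasure m a \<noteq> \<infinity>"
    by blast
  have sub: "range (\<lambda>n. L n \<inter> S) \<subseteq> sets m"
    using m compact_imp_closed[OF L(1)]
    by (auto simp: haar_measure_def sets_restrict_space)
  have cover: "\<Union>(range (\<lambda>n. L n \<inter> S)) = space m"
  proof -
    have "x \<in> (\<Union>n. L n)" for x
      unfolding L(2)[symmetric] by (rule UNIV_I)
    then show ?thesis
      unfolding haar_measure_space[OF m] by auto
  qed
  have "countable (range (\<lambda>n. L n \<inter> S))" by simp
  then show ?thesis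
    using fin sub cover by (intro sigma_finite_measure.intro exI conjI)
qed

text \<open>The members of a compact exhaustion cannot all be null. The set found here normalizes
  the transverse measure and is the test set in the proofs of its invariance and uniqueness.\<close>

lemma haar_measure_compact_pos:
  fixes m :: "'g::{topological_group_add, second_countable_topology, t2_space} measure"
  assumes lc: "locally_compact_space (euclidean :: 'g topology)"
    and m: "haar_measure UNIV m"
  obtains K where "compact K" "0 < emeasure m K" "emeasure m K < \<infinity>"
proof -
  obtain L :: "nat \<Rightarrow> 'g set" where L: "\<And>n. compact (L n)" "UNIV = (\<Union>n. L n)"
    using open_eq_countable_Union_compact[OF lc open_UNIV] by blast
  have sets: "L n \<in> sets m" for n
    using borel_closed[OF compact_imp_closed[OF L(1)]] haar_measure_sets_UNIV[OF m] by simp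
  have "emeasure m (\<Union>n. L n) \<noteq> 0"
    using m unfolding L(2)[symmetric] haar_measure_def by blast
  then obtain n where "emeasure m (L n) \<noteq> 0"
    using emeasure_UN_eq_0[of m L] sets by blast
  with L(1)[of n] m show thesis
    by (intro that[of "L n"]) (auto simp: haar_measure_def zero_less_iff_neq_zero)
qed

section \<open>Cosets, and measurability of counts and sums over them\<close>

lemma rcoset_eq_iff:
  assumes "add_subgroup H"
  shows "rcoset H g = rcoset H g' \<longleftrightarrow> g - g' \<in> H"
proof
  assume "rcoset H g = rcoset H g'"
  moreover have "0 + g \<in> rcoset H g"
    unfolding rcoset_def using assms by (intro imageI) (auto simp: add_subgroup_def)
  ultimately obtain h where "h \<in> H" "g = h + g'"
    by (auto simp: rcoset_def)
  then show "g - g' \<in> H" by simp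
next
  have sub: "rcoset H g \<subseteq> rcoset H g'" if "g - g' \<in> H" for g g'
  proof
    fix x assume "x \<in> rcoset H g"
    then obtain h where h: "h \<in> H" "x = h + g" by (auto simp: rcoset_def)
    then have "x = (h + (g - g')) + g'" by (simp add: add.assoc)
    moreover have "h + (g - g') \<in> H" using h that assms by (simp add: add_subgroup_def)
    ultimately show "x \<in> rcoset H g'" unfolding rcoset_def by blast
  qed
  assume "g - g' \<in> H"
  moreover have "g' - g \<in> H"
    using assms calculation unfolding add_subgroup_def by (metis minus_diff_eq)
  ultimately show "rcoset H g = rcoset H g'"
    using sub by blast
qed

lemma rcoset_plus: "add_subgroup H \<Longrightarrow> h \<in> H \<Longrightarrow> rcoset H (h + g) = rcoset H g"
  by (simp add: rcoset_eq_iff)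

lemma coset_rep_rcoset:
  assumes "add_subgroup H"
  obtains h where "h \<in> H" "coset_rep (rcoset H g) = h + g"
proof -
  have "0 + g \<in> rcoset H g"
    unfolding rcoset_def using assms by (intro imageI) (auto simp: add_subgroup_def)
  then have "coset_rep (rcoset H g) \<in> rcoset H g"
    unfolding coset_rep_def by (rule someI)
  then show thesis using that by (auto simp: rcoset_def)
qed

text \<open>Cells of the partitions are unions of cosets, so the number of cells met by a section
  never exceeds its number of cosets; conversely any finitely many cosets lie in distinct cells from
  some stage on. Hence the count is the supremum of finite sums of indicators of
  projections.\<close>

lemma borel_measurable_coset_count:
  fixes H :: "'g::{topological_group_add, second_countable_topology, t2_space} set"
  assumes lc: "locally_compact_space (euclidean :: 'g topology)"
    and H: "add_subgroup H" "closed H"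
    and M: "finite_measure M" and B: "B \<in> sets (borel \<Otimes>\<^sub>M M)"
  shows "(\<lambda>x. emeasure (count_space UNIV) (rcoset H ` {g. (g, x) \<in> B}))
    \<in> borel_measurable (completion M)"
proof -
  obtain \<U> :: "'g set set" where \<U>: "countable \<U>" "topological_basis \<U>"
    using ex_countable_basis by blast
  have "\<U> \<noteq> {}"
    using topological_basisE[OF \<U>(2) open_UNIV, of 0] by blast
  \<comment> \<open>\<open>V n\<close> is the saturation of the \<open>n\<close>-th basic open set,
    the preimage of its image in the coset space.\<close>
  define V where "V n = (\<Union>h\<in>H. (\<lambda>g. h + g) -` from_nat_into \<U> n)" for n
  have V_open: "open (V n)" for n
    unfolding V_def using from_nat_into[OF \<open>\<U> \<noteq> {}\<close>] \<U>(2)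
    by (intro open_UN ballI open_vimage continuous_intros) (auto simp: topological_basis_open)
  have V_sat: "g \<in> V n" if "g' \<in> V n" "g - g' \<in> H" for g g' n
  proof -
    obtain h where h: "h \<in> H" "h + g' \<in> from_nat_into \<U> n"
      using \<open>g' \<in> V n\<close> by (auto simp: V_def)
    have "g' - g \<in> H"
      using that(2) H(1) unfolding add_subgroup_def by (metis minus_diff_eq)
    then have "h + (g' - g) \<in> H"
      using h(1) H(1) by (simp add: add_subgroup_def)
    moreover have "h + (g' - g) + g = h + g'"
      by (simp add: add.assoc)
    ultimately show ?thesis unfolding V_def using h(2) by force
  qed
  \<comment> \<open>Since \<open>H\<close> is closed, the complement of the coset of
    \<open>g'\<close> is open and contains a basic neighbourhood of \<open>g\<close>. The saturation
    of this neighbourhood still misses \<open>g'\<close>.\<close>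
  have V_sep: "\<exists>n. g \<in> V n \<and> g' \<notin> V n" if "rcoset H g \<noteq> rcoset H g'" for g g'
  proof -
    have "open ((\<lambda>x. x - g') -` (- H))"
      using H(2) by (intro open_vimage continuous_intros) auto
    moreover have "g \<in> (\<lambda>x. x - g') -` (- H)"
      using that rcoset_eq_iff[OF H(1)] by simp
    ultimately obtain b where b: "b \<in> \<U>" "g \<in> b" "b \<subseteq> (\<lambda>x. x - g') -` (- H)"
      using topological_basisE[OF \<U>(2)] by blast
    obtain n where n: "b = from_nat_into \<U> n"
      using from_nat_into_surj[OF \<U>(1) b(1)] by metis
    have "g \<in> V n"
      using b(2) H(1) unfolding V_def n by (auto simp: add_subgroup_def intro!: bexI[of _ 0])
    moreover have "g' \<notin> V n"
      using b(3) unfolding V_def n by auto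
    ultimately show ?thesis by blast
  qed
  \<comment> \<open>The sets \<open>atom n J\<close> are ever finer partitions of \<open>G\<close> into \<open>H\<close>-saturated sets.\<close>
  define atom where "atom n J = {g. \<forall>i<n. g \<in> V i \<longleftrightarrow> i \<in> J}" for n :: nat and J
  define hit where "hit n J = snd ` (B \<inter> atom n J \<times> space M)" for n J
  have hit: "x \<in> hit n J \<longleftrightarrow> (\<exists>g. (g, x) \<in> B \<and> g \<in> atom n J)" for x n J
    using sets.sets_into_space[OF B] unfolding hit_def
    by (force simp: space_pair_measure)
  have [measurable]: "hit n J \<in> sets (completion M)" for n J
  proof -
    have "atom n J = (\<Inter>i\<in>{..<n}. if i \<in> J then V i else - V i)"
      by (auto simp: atom_def split: if_splits)
    also have "\<dots> \<in> sets borel"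
    proof (cases "n = 0")
      case False
      have "(if i \<in> J then V i else - V i) \<in> sets borel" for i
        using V_open[of i] by auto
      with False show ?thesis by (intro sets.finite_INT) auto
    qed simp
    finally show ?thesis
      unfolding hit_def using B by (intro measurable_projection[OF lc M] sets.Int pair_measureI) auto
  qed
  have card_eq: "(\<Sum>J\<in>Pow {..<n}. indicator (hit n J) x :: ennreal) =
      of_nat (card {J\<in>Pow {..<n}. x \<in> hit n J})" for n x
    by (simp add: indicator_def sum.If_cases Int_def conj_commute)
  have "emeasure (count_space UNIV) (rcoset H ` {g. (g, x) \<in> B}) =
      (SUP n. \<Sum>J\<in>Pow {..<n}. indicator (hit n J) x)" (is "emeasure _ ?S = ?R") for x
  proof (rule antisym)
    have T: "of_nat (card T) \<le> ?R" if "finite T" "T \<subseteq> ?S" for T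
    proof -
      have "\<forall>C\<in>T. \<exists>g. (g, x) \<in> B \<and> C = rcoset H g" using that(2) by blast
      then obtain r where r: "\<And>C. C \<in> T \<Longrightarrow> (r C, x) \<in> B \<and> C = rcoset H (r C)" by metis
      have "\<forall>\<^sub>F n in sequentially. C \<noteq> D \<longrightarrow> (\<exists>i<n. r C \<in> V i \<and> r D \<notin> V i)"
        if CD: "C \<in> T" "D \<in> T" for C D
      proof (cases "C = D")
        case False
        then have "rcoset H (r C) \<noteq> rcoset H (r D)" using r[OF CD(1)] r[OF CD(2)] by simp
        then obtain i where "r C \<in> V i \<and> r D \<notin> V i" using V_sep by blast
        then show ?thesis
          by (intro eventually_mono[OF eventually_gt_at_top[of i]]) blast
      qed auto
      then have "\<forall>\<^sub>F n in sequentially. \<forall>C\<in>T. \<forall>D\<in>T. C \<noteq> D \<longrightarrow> (\<exists>i<n. r C \<in> V i \<and> r D \<notin> V i)"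
        using \<open>finite T\<close> by (simp add: eventually_ball_finite_distrib)
      then obtain n where n: "\<And>C D. C \<in> T \<Longrightarrow> D \<in> T \<Longrightarrow> C \<noteq> D \<Longrightarrow> \<exists>i<n. r C \<in> V i \<and> r D \<notin> V i"
        using eventually_happens[of _ sequentially] by fastforce
      have "card T \<le> card {J\<in>Pow {..<n}. x \<in> hit n J}"
      proof (rule card_inj_on_le)
        show "inj_on (\<lambda>C. {i. i < n \<and> r C \<in> V i}) T"
        proof (rule inj_onI, rule ccontr)
          fix C D assume CD: "C \<in> T" "D \<in> T" "{i. i < n \<and> r C \<in> V i} = {i. i < n \<and> r D \<in> V i}" "C \<noteq> D"
          then show False using n[OF CD(1,2,4)] by blast
        qed
        show "(\<lambda>C. {i. i < n \<and> r C \<in> V i}) ` T \<subseteq> {J\<in>Pow {..<n}. x \<in> hit n J}"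
          using r by (auto simp: hit atom_def)
      qed simp
      then have "of_nat (card T) \<le> (\<Sum>J\<in>Pow {..<n}. indicator (hit n J) x :: ennreal)"
        unfolding card_eq by (simp del: of_nat_sum)
      also have "\<dots> \<le> ?R" by (rule SUP_upper) simp
      finally show ?thesis .
    qed
    show "emeasure (count_space UNIV) ?S \<le> ?R"
    proof (cases "finite ?S")
      case True
      then show ?thesis using T[of ?S] by simp
    next
      case False
      have "of_nat k \<le> ?R" for k
        using infinite_arbitrarily_large[OF False, of k] T by blast
      then have "(SUP k. of_nat k :: ennreal) \<le> ?R" by (intro SUP_least)
      then have "top \<le> ?R" unfolding ennreal_SUP_of_nat_eq_top .
      then show ?thesis by (rule order_trans[OF top_greatest])
    qed
    show "?R \<le> emeasure (count_space UNIV) ?S"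
    proof (rule SUP_least)
      fix n
      have "\<forall>J. x \<in> hit n J \<longrightarrow> (\<exists>g. (g, x) \<in> B \<and> g \<in> atom n J)" by (simp add: hit)
      then obtain q where q: "\<And>J. x \<in> hit n J \<Longrightarrow> (q J, x) \<in> B \<and> q J \<in> atom n J" by metis
      have "card {J\<in>Pow {..<n}. x \<in> hit n J} \<le> card ?S" if "finite ?S"
      proof (rule card_inj_on_le[OF _ _ that])
        show "inj_on (\<lambda>J. rcoset H (q J)) {J\<in>Pow {..<n}. x \<in> hit n J}"
        proof (rule inj_onI)
          fix J J' assume J: "J \<in> {J\<in>Pow {..<n}. x \<in> hit n J}" "J' \<in> {J\<in>Pow {..<n}. x \<in> hit n J}"
            and eq: "rcoset H (q J) = rcoset H (q J')"
          have "q J \<in> V i \<longleftrightarrow> q J' \<in> V i" for i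
            using V_sat[of "q J" i "q J'"] V_sat[of "q J'" i "q J"] eq
              rcoset_eq_iff[OF H(1), of "q J" "q J'"] rcoset_eq_iff[OF H(1), of "q J'" "q J"]
            by auto
          then have "i \<in> J \<longleftrightarrow> i \<in> J'" if "i < n" for i
            using q[of J] q[of J'] J that by (auto simp: atom_def)
          then show "J = J'" using J by auto
        qed
        show "(\<lambda>J. rcoset H (q J)) ` {J\<in>Pow {..<n}. x \<in> hit n J} \<subseteq> ?S"
          using q by auto
      qed
      then show "(\<Sum>J\<in>Pow {..<n}. indicator (hit n J) x) \<le> emeasure (count_space UNIV) ?S"
        unfolding card_eq by (cases "finite ?S") (auto simp: emeasure_count_space)
    qed
  qed
  then show ?thesis by (simp del: emeasure_count_space)
qed

text \<open>The induction runs over a function \<open>u\<close> applied to the values of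
  \<open>f\<close>, not over \<open>f\<close>: composites with \<open>f\<close> inherit its
  invariance under \<open>H\<close>, whereas the building blocks of an induction over
  \<open>f\<close> would not. For \<open>u\<close> the indicator of \<open>A\<close> the sum counts
  the cosets on which \<open>f\<close> lies in \<open>A\<close>, which is the previous lemma with
  \<open>B\<close> cut down to the preimage of \<open>A\<close>. The result is the case of the
  identity.\<close>

lemma borel_measurable_coset_sum:
  fixes H :: "'g::{topological_group_add, second_countable_topology, t2_space} set"
    and f :: "'g \<times> 'x \<Rightarrow> ennreal"
  assumes lc: "locally_compact_space (euclidean :: 'g topology)"
    and H: "add_subgroup H" "closed H"
    and M: "finite_measure M" and B: "B \<in> sets (borel \<Otimes>\<^sub>M M)"
    and f: "f \<in> borel_measurable (borel \<Otimes>\<^sub>M M)"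
    and inv: "\<And>h g x. h \<in> H \<Longrightarrow> x \<in> space M \<Longrightarrow> f (h + g, x) = f (g, x)"
  shows "(\<lambda>x. \<integral>\<^sup>+C. f (coset_rep C, x) \<partial>count_space (rcoset H ` {g. (g, x) \<in> B}))
    \<in> borel_measurable (completion M)"
proof -
  have "(\<lambda>x. \<integral>\<^sup>+C. u (f (coset_rep C, x)) \<partial>count_space (rcoset H ` {g. (g, x) \<in> B}))
    \<in> borel_measurable (completion M)" if "u \<in> borel_measurable borel" for u :: "ennreal \<Rightarrow> ennreal"
    using that
  proof (induction u rule: borel_measurable_induct)
    case (cong u v)
    then have "u = v" by auto
    with cong show ?case by simp
  next
    case (set A)
    have "B \<inter> (f -` A \<inter> space (borel \<Otimes>\<^sub>M M)) \<in> sets (borel \<Otimes>\<^sub>M M)"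
      using B measurable_sets[OF f set] by blast
    from borel_measurable_coset_count[OF lc H M this]
    show ?case
    proof (rule measurable_cong[THEN iffD1, rotated])
      fix x assume x: "x \<in> space (completion M)"
      let ?S = "rcoset H ` {g. (g, x) \<in> B}"
      have "f (coset_rep (rcoset H g), x) = f (g, x)" for g
        using inv x coset_rep_rcoset[OF H(1), of g] by (metis space_completion)
      then have eq: "rcoset H ` {g. (g, x) \<in> B \<inter> (f -` A \<inter> space (borel \<Otimes>\<^sub>M M))} =
          {C \<in> ?S. f (coset_rep C, x) \<in> A}"
        using x by (auto simp: space_pair_measure)
      have "(\<integral>\<^sup>+C. indicator A (f (coset_rep C, x)) \<partial>count_space ?S) =
          (\<integral>\<^sup>+C. indicator {C \<in> ?S. f (coset_rep C, x) \<in> A} C \<partial>count_space ?S)"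
        by (intro nn_integral_cong) (auto simp: indicator_def)
      also have "\<dots> = emeasure (count_space ?S) {C \<in> ?S. f (coset_rep C, x) \<in> A}"
        by (intro nn_integral_indicator) auto
      also have "\<dots> = emeasure (count_space UNIV) {C \<in> ?S. f (coset_rep C, x) \<in> A}"
        by (simp add: emeasure_count_space)
      finally show "emeasure (count_space UNIV) (rcoset H ` {g. (g, x) \<in> B \<inter> (f -` A \<inter> space (borel \<Otimes>\<^sub>M M))}) =
          (\<integral>\<^sup>+C. indicator A (f (coset_rep C, x)) \<partial>count_space ?S)"
        unfolding eq by simp
    qed
  next
    case (mult u c)
    then show ?case by (simp add: nn_integral_cmult)
  next
    case (add u v)
    then show ?case by (simp add: nn_integral_add)
  next
    case (seq U)
    have "(\<integral>\<^sup>+C. (SUP i. U i) (f (coset_rep C, x)) \<partial>count_space S) =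
        (SUP i. \<integral>\<^sup>+C. U i (f (coset_rep C, x)) \<partial>count_space S)" for x S
      unfolding SUP_apply
      using seq(3) by (intro nn_integral_monotone_convergence_SUP) (auto simp: incseq_def le_fun_def)
    then show ?case using seq by simp
  qed
  from this[of "\<lambda>y. y"] show ?thesis by simp
qed

lemma compactin_coset_image:
  assumes "compact K"
  shows "compactin (coset_space H) (rcoset H ` K)"
proof (rule image_compactin)
  show "compactin euclidean K" using assms by simp
  show "continuous_map euclidean (coset_space H) (rcoset H)"
    unfolding continuous_map_def
    by (auto simp: topspace_coset_space openin_coset_space vimage_def)
qed

text \<open>The classical uniqueness argument: integrate
  \<open>indicator K y * indicator E (y + x)\<close> in both orders. Left invariance of
  \<open>l\<close> evaluates one order; the substitution of \<open>y - x\<close> for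
  \<open>y\<close>, by right invariance of \<open>m\<close>, and then right invariance of
  \<open>l\<close> evaluate the other. The inverse of \<open>K\<close> arises because
  \<open>y - x \<in> K\<close> becomes a condition on \<open>x - y\<close>; it is kept, so
  invariance of \<open>l\<close> under inversion is never invoked.\<close>

lemma haar_measure_proportional:
  fixes m l :: "'g::{topological_group_add, second_countable_topology} measure"
  assumes m: "sets m = sets borel" "sigma_finite_measure m" "\<And>g. distr m m (\<lambda>x. x + g) = m"
    and l: "sets l = sets borel" "sigma_finite_measure l"
      "\<And>g. distr l l (\<lambda>x. g + x) = l" "\<And>g. distr l l (\<lambda>x. x + g) = l"
    and K [measurable]: "K \<in> sets borel" and E [measurable]: "E \<in> sets borel"
  shows "emeasure m K * emeasure l E = emeasure m E * emeasure l (uminus ` K)"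
proof -
  note [measurable_cong] = m(1) l(1)
  interpret pair_sigma_finite m l
    using m(2) l(2) by (rule pair_sigma_finite.intro)
  have [measurable]: "(\<lambda>x. f x - k x) \<in> borel_measurable N"
    if "f \<in> borel_measurable N" "k \<in> borel_measurable N" for f k :: "_ \<Rightarrow> 'g" and N
  proof -
    have "(\<lambda>x. - k x) \<in> borel_measurable N"
      using that(2) borel_measurable_continuous_onI[OF continuous_on_minus[OF continuous_on_id]]
      by (rule measurable_compose)
    then show ?thesis
      unfolding diff_conv_add_uminus using that(1) by (intro borel_measurable_add)
  qed
  have m_right: "(\<integral>\<^sup>+x. f (x + g) \<partial>m) = (\<integral>\<^sup>+x. f x \<partial>m)" if [measurable]: "f \<in> borel_measurable borel" for f g
    using nn_integral_distr[of "\<lambda>x. x + g" m m f] by (simp add: m(3))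
  have l_left: "(\<integral>\<^sup>+x. f (g + x) \<partial>l) = (\<integral>\<^sup>+x. f x \<partial>l)" if [measurable]: "f \<in> borel_measurable borel" for f g
    using nn_integral_distr[of "\<lambda>x. g + x" l l f] by (simp add: l(3))
  have l_right: "(\<integral>\<^sup>+x. f (x + g) \<partial>l) = (\<integral>\<^sup>+x. f x \<partial>l)" if [measurable]: "f \<in> borel_measurable borel" for f g
    using nn_integral_distr[of "\<lambda>x. x + g" l l f] by (simp add: l(4))
  have "(uminus :: 'g \<Rightarrow> 'g) \<in> borel_measurable borel"
    by (rule borel_measurable_continuous_onI[OF continuous_on_minus[OF continuous_on_id]])
  from measurable_sets_borel[OF this K]
  have "uminus -` K \<in> sets borel" .
  moreover have "uminus -` K = uminus ` K"
    by force
  ultimately have [measurable]: "uminus ` K \<in> sets borel"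
    by simp
  have "emeasure m K * emeasure l E = (\<integral>\<^sup>+y. indicator K y * (\<integral>\<^sup>+x. indicator E x \<partial>l) \<partial>m)"
    by (simp add: nn_integral_multc)
  also have "\<dots> = (\<integral>\<^sup>+y. indicator K y * (\<integral>\<^sup>+x. indicator E (y + x) \<partial>l) \<partial>m)"
    using l_left[of "indicator E"] by simp
  also have "\<dots> = (\<integral>\<^sup>+y. \<integral>\<^sup>+x. indicator K y * indicator E (y + x) \<partial>l \<partial>m)"
    by (intro nn_integral_cong nn_integral_cmult[symmetric]) measurable
  also have "\<dots> = (\<integral>\<^sup>+x. \<integral>\<^sup>+y. indicator K y * indicator E (y + x) \<partial>m \<partial>l)"
    by (rule Fubini'[symmetric]) measurable
  also have "\<dots> = (\<integral>\<^sup>+x. \<integral>\<^sup>+y. indicator K (y - x) * indicator E y \<partial>m \<partial>l)"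
  proof (rule nn_integral_cong)
    fix x
    show "(\<integral>\<^sup>+y. indicator K y * indicator E (y + x) \<partial>m) = (\<integral>\<^sup>+y. indicator K (y - x) * indicator E y \<partial>m)"
      using m_right[of "\<lambda>y. indicator K y * indicator E (y + x)" "- x"] by (simp add: add.assoc)
  qed
  also have "\<dots> = (\<integral>\<^sup>+y. \<integral>\<^sup>+x. indicator K (y - x) * indicator E y \<partial>l \<partial>m)"
    by (rule Fubini') measurable
  also have "\<dots> = (\<integral>\<^sup>+y. (\<integral>\<^sup>+x. indicator K (y - x) \<partial>l) * indicator E y \<partial>m)"
    by (intro nn_integral_cong nn_integral_multc) measurable
  also have "\<dots> = (\<integral>\<^sup>+y. emeasure l (uminus ` K) * indicator E y \<partial>m)"
  proof (rule nn_integral_cong)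
    fix y
    have "indicator K (y - x) = (indicator (uminus ` K) (x + - y) :: ennreal)" for x
    proof -
      have "x + - y = - (y - x)" by simp
      then have "x + - y \<in> uminus ` K \<longleftrightarrow> y - x \<in> K"
        by (simp only: inj_image_mem_iff[OF inj_uminus])
      then show ?thesis by (simp only: indicator_def)
    qed
    then show "(\<integral>\<^sup>+x. indicator K (y - x) \<partial>l) * indicator E y = emeasure l (uminus ` K) * indicator E y"
      using l_right[of "indicator (uminus ` K)" "- y"] by simp
  qed
  also have "\<dots> = emeasure m E * emeasure l (uminus ` K)"
    by (subst nn_integral_cmult_indicator) (simp_all add: m(1) mult.commute)
  finally show ?thesis .
qed

text \<open>In the completion a set that agrees with a measurable set almost everywhere is
  measurable. This transfers measurability to the complex periodization, which is compared with
  measurable functions only off a null set.\<close>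

lemma borel_measurable_completion_AE:
  assumes f: "f \<in> borel_measurable (completion M)" and ae: "AE x in completion M. f x = g x"
  shows "g \<in> borel_measurable (completion M)"
proof (rule measurableI)
  fix A :: "'b set" assume "A \<in> sets borel"
  then have "f -` A \<inter> space (completion M) \<in> sets (completion M)"
    using f by (rule measurable_sets[rotated])
  then show "g -` A \<inter> space (completion M) \<in> sets (completion M)"
  proof (rule completion.in_sets_AE[rotated])
    show "AE x in completion M. x \<in> f -` A \<inter> space (completion M) \<longleftrightarrow> x \<in> g -` A \<inter> space (completion M)"
      using ae by eventually_elim auto
  qed auto
qed simp

text \<open>Test functions are measurable on \<open>G \<times> Y\<close> only and arbitrary
  elsewhere; cutting them off outside \<open>Y\<close> makes them functions on
  \<open>G \<times> X\<close>.\<close>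

lemma borel_measurable_extend_snd:
  fixes F :: "'a::topological_space \<times> 'b \<Rightarrow> complex"
  assumes F: "F \<in> borel_measurable (borel \<Otimes>\<^sub>M restrict_space X Y)" and Y: "Y \<in> sets X"
  shows "(\<lambda>z. indicator (UNIV \<times> Y) z *\<^sub>R F z) \<in> borel_measurable (borel \<Otimes>\<^sub>M X)"
proof -
  have UY: "(UNIV \<times> Y) \<inter> space (borel \<Otimes>\<^sub>M X) \<in> sets (borel \<Otimes>\<^sub>M X)"
    using Y by (intro sets.Int pair_measureI) auto
  let ?R = "restrict_space (borel \<Otimes>\<^sub>M X) (UNIV \<times> Y)"
  have "(\<lambda>z. (fst z, snd z)) \<in> ?R \<rightarrow>\<^sub>M borel \<Otimes>\<^sub>M restrict_space X Y"
    by (intro measurable_Pair measurable_restrict_space2 measurable_restrict_space1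
        measurable_fst measurable_snd)
      (auto simp: space_restrict_space)
  from measurable_compose[OF this F] have "F \<in> borel_measurable ?R"
    by simp
  then show ?thesis
    by (simp add: borel_measurable_restrict_space_iff[OF UY])
qed

section \<open>The periodization of nonnegative functions\<close>

locale transverse =
  fixes H :: "'g::{topological_group_add, second_countable_topology, t2_space} set"
    and mG mH :: "'g measure"
    and X \<mu> :: "'x measure"
    and act :: "'g \<Rightarrow> 'x \<Rightarrow> 'x"
    and Y :: "'x set"
  assumes lc: "locally_compact_space (euclidean :: 'g topology)"
    and uniG: "unimodular (UNIV :: 'g set)"
    and subgroup_H: "add_subgroup H" and closed_H: "closed H" and uniH: "unimodular H"
    and haar_G: "haar_measure UNIV mG" and haar_H: "haar_measure H mH"
    and integrable_sys: "integrable_transverse_system H X act Y \<mu>"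
begin

lemma H_add: "g \<in> H \<Longrightarrow> h \<in> H \<Longrightarrow> g + h \<in> H"
  and H_uminus: "g \<in> H \<Longrightarrow> - g \<in> H"
  using subgroup_H by (auto simp: add_subgroup_def)

lemma system: "transverse_system H X act Y \<mu>"
  using integrable_sys by (simp add: integrable_transverse_system_def)

lemma sets_\<mu> [measurable_cong]: "sets \<mu> = sets X"
  using system by (simp add: transverse_system_def)

lemma space_\<mu>: "space \<mu> = space X"
  using sets_\<mu> by (rule sets_eq_imp_space_eq)

sublocale prob_space \<mu>
  using system by (simp add: transverse_system_def)

lemma act_zero: "x \<in> space X \<Longrightarrow> act 0 x = x"
  and act_add: "x \<in> space X \<Longrightarrow> act (g + h) x = act g (act h x)"
  and act_measurable_X: "(\<lambda>(g, x). act g x) \<in> borel \<Otimes>\<^sub>M X \<rightarrow>\<^sub>M X"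
  using system by (auto simp: transverse_system_def standard_borel_G_space_def)

lemma act_measurable [measurable (raw)]:
  assumes "f \<in> N \<rightarrow>\<^sub>M borel" "k \<in> N \<rightarrow>\<^sub>M X"
  shows "(\<lambda>z. act (f z) (k z)) \<in> N \<rightarrow>\<^sub>M X"
  using measurable_compose[OF measurable_Pair[OF assms] act_measurable_X] by simp

lemma act_space: "x \<in> space X \<Longrightarrow> act g x \<in> space X"
  using measurable_space[OF act_measurable[of "\<lambda>_. g" X "\<lambda>x. x"]] by simp

lemma act_uminus: "x \<in> space X \<Longrightarrow> act (- g) (act g x) = x"
  by (simp add: act_add[symmetric] act_zero)

lemma distr_act: "distr \<mu> \<mu> (act g) = \<mu>"
  using system by (simp add: transverse_system_def)

lemma Y_sets [measurable]: "Y \<in> sets X"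
  using system by (simp add: transverse_system_def cross_section_def)

lemma Y_space: "y \<in> Y \<Longrightarrow> y \<in> space X"
  using sets.sets_into_space[OF Y_sets] by blast

lemma H_act_Y: "h \<in> H \<Longrightarrow> y \<in> Y \<Longrightarrow> act h y \<in> Y"
  using system by (auto simp: transverse_system_def cross_section_def)

lemma sets_mG [measurable_cong]: "sets mG = sets borel"
  using haar_G by (rule haar_measure_sets_UNIV)

lemma space_mG: "space mG = UNIV"
  using haar_G by (rule haar_measure_space)

lemma sets_mH: "sets mH = sets (restrict_space borel H)"
  using haar_H by (simp add: haar_measure_def)

lemma space_mH: "space mH = H"
  using haar_H by (rule haar_measure_space)

sublocale mG: sigma_finite_measure mG
  by (rule haar_measure_sigma_finite[OF lc closed_UNIV haar_G])

sublocale mH: sigma_finite_measure mH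
  by (rule haar_measure_sigma_finite[OF lc closed_H haar_H])

lemma measurable_mH_borel: "(\<lambda>h. h) \<in> mH \<rightarrow>\<^sub>M borel"
  using measurable_restrict_space1[of "\<lambda>h. h" borel borel H]
  by (simp add: measurable_cong_sets[OF sets_mH refl])

lemma measurable_into_mH: "f \<in> N \<rightarrow>\<^sub>M borel \<Longrightarrow> (\<And>z. z \<in> space N \<Longrightarrow> f z \<in> H) \<Longrightarrow> f \<in> N \<rightarrow>\<^sub>M mH"
  using measurable_restrict_space2[of f N H borel]
  by (simp add: measurable_cong_sets[OF refl sets_mH] Pi_def)

lemma nn_integral_mH_left:
  assumes f: "f \<in> borel_measurable mH" and h0: "h0 \<in> H"
  shows "(\<integral>\<^sup>+h. f (h0 + h) \<partial>mH) = (\<integral>\<^sup>+h. f h \<partial>mH)"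
proof -
  have "(\<lambda>h. h0 + h) \<in> borel \<rightarrow>\<^sub>M borel" by measurable
  from measurable_compose[OF measurable_mH_borel this]
  have "(\<lambda>h. h0 + h) \<in> mH \<rightarrow>\<^sub>M mH"
    using h0 by (intro measurable_into_mH) (auto simp: space_mH H_add)
  then show ?thesis
    using nn_integral_distr[of "\<lambda>h. h0 + h" mH mH f] f haar_H h0 by (simp add: haar_measure_def)
qed

lemma nn_integral_mH_right:
  assumes f: "f \<in> borel_measurable mH" and h0: "h0 \<in> H"
  shows "(\<integral>\<^sup>+h. f (h + h0) \<partial>mH) = (\<integral>\<^sup>+h. f h \<partial>mH)"
proof -
  have "(\<lambda>h. h + h0) \<in> borel \<rightarrow>\<^sub>M borel" by measurable
  from measurable_compose[OF measurable_mH_borel this]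
  have "(\<lambda>h. h + h0) \<in> mH \<rightarrow>\<^sub>M mH"
    using h0 by (intro measurable_into_mH) (auto simp: space_mH H_add)
  then show ?thesis
    using nn_integral_distr[of "\<lambda>h. h + h0" mH mH f] f haar_H uniH h0 by (simp add: unimodular_def)
qed

lemma uminus_measurable [measurable (raw)]:
  "f \<in> N \<rightarrow>\<^sub>M borel \<Longrightarrow> (\<lambda>z. - f z :: 'g) \<in> N \<rightarrow>\<^sub>M borel"
  using measurable_compose[OF _ borel_measurable_continuous_onI[OF continuous_on_minus[OF continuous_on_id]]]
  by blast

section \<open>Orbit functions, fiber integrals and the measure they define\<close>

definition Z :: "('g \<times> 'x) set" where
  "Z = {z \<in> space (borel \<Otimes>\<^sub>M \<mu>). act (fst z) (snd z) \<in> Y}"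

lemma Z_sets [measurable]: "Z \<in> sets (borel \<Otimes>\<^sub>M \<mu>)"
  unfolding Z_def by measurable

lemma hitting_eq: "x \<in> space X \<Longrightarrow> hitting H act Y x = rcoset H ` {g. (g, x) \<in> Z}"
  by (auto simp: hitting_def Z_def space_pair_measure space_\<mu>)

text \<open>The integrand of the periodization along the coset of \<open>fst z\<close>, as a
  function of \<open>h\<close>. It is polymorphic in the values so that the nonnegative and the
  complex theory share it.\<close>

definition orbit :: "('g \<times> 'x \<Rightarrow> 'a) \<Rightarrow> 'g \<times> 'x \<Rightarrow> 'g \<Rightarrow> 'a" where
  "orbit F z = (\<lambda>h. F (- (h + fst z), act (h + fst z) (snd z)))"

lemma orbit_measurable [measurable]:
  assumes [measurable]: "F \<in> borel \<Otimes>\<^sub>M \<mu> \<rightarrow>\<^sub>M N" and x: "x \<in> space X"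
  shows "orbit F (g, x) \<in> mH \<rightarrow>\<^sub>M N"
proof -
  have "orbit F (g, x) \<in> borel \<rightarrow>\<^sub>M N"
    using x unfolding orbit_def fst_conv snd_conv by measurable
  then show ?thesis by (rule measurable_compose[OF measurable_mH_borel])
qed

lemma orbit_shift: "orbit F (h0 + g, x) h = orbit F (g, x) (h + h0)"
  by (simp add: orbit_def add.assoc)

definition fiber :: "('g \<times> 'x \<Rightarrow> ennreal) \<Rightarrow> 'g \<times> 'x \<Rightarrow> ennreal" where
  "fiber F z = (\<integral>\<^sup>+h. orbit F z h \<partial>mH)"

definition T :: "('g \<times> 'x \<Rightarrow> ennreal) \<Rightarrow> 'x \<Rightarrow> ennreal" where
  "T F x = (\<integral>\<^sup>+C. fiber F (coset_rep C, x) \<partial>count_space (hitting H act Y x))"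

lemma fiber_measurable [measurable]:
  assumes [measurable]: "F \<in> borel_measurable (borel \<Otimes>\<^sub>M \<mu>)"
  shows "fiber F \<in> borel_measurable (borel \<Otimes>\<^sub>M \<mu>)"
proof -
  have "(\<lambda>w. orbit F (fst w) (snd w)) \<in> borel_measurable ((borel \<Otimes>\<^sub>M \<mu>) \<Otimes>\<^sub>M borel)"
    unfolding orbit_def by measurable
  from measurable_compose[OF measurable_Pair[OF measurable_fst
      measurable_compose[OF measurable_snd measurable_mH_borel]] this]
  have "(\<lambda>w. orbit F (fst w) (snd w)) \<in> borel_measurable ((borel \<Otimes>\<^sub>M \<mu>) \<Otimes>\<^sub>M mH)"
    by simp
  then show ?thesis
    unfolding fiber_def by (intro mH.borel_measurable_nn_integral) (simp add: split_beta')
qed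

text \<open>Changing the representative by \<open>h0\<close> translates the integration variable on
  the right, which right invariance of \<open>mH\<close> absorbs; here unimodularity of
  \<open>H\<close> enters.\<close>

lemma fiber_invariant:
  assumes [measurable]: "F \<in> borel_measurable (borel \<Otimes>\<^sub>M \<mu>)" and "h0 \<in> H" "x \<in> space X"
  shows "fiber F (h0 + g, x) = fiber F (g, x)"
  unfolding fiber_def orbit_shift using assms by (intro nn_integral_mH_right) auto

lemma fiber_coset_rep:
  assumes "F \<in> borel_measurable (borel \<Otimes>\<^sub>M \<mu>)" and "x \<in> space X"
  shows "fiber F (coset_rep (rcoset H g), x) = fiber F (g, x)"
  using coset_rep_rcoset[OF subgroup_H, of g] fiber_invariant[OF assms(1) _ assms(2)] by metis

lemma T_measurable [measurable]:
  assumes "F \<in> borel_measurable (borel \<Otimes>\<^sub>M \<mu>)"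
  shows "T F \<in> borel_measurable (completion \<mu>)"
proof -
  have "(\<lambda>x. \<integral>\<^sup>+C. fiber F (coset_rep C, x) \<partial>count_space (rcoset H ` {g. (g, x) \<in> Z}))
      \<in> borel_measurable (completion \<mu>)"
    using assms fiber_invariant
    by (intro borel_measurable_coset_sum[OF lc subgroup_H closed_H finite_measure_axioms Z_sets])
      (auto simp: space_\<mu>)
  then show ?thesis
    by (rule measurable_cong[THEN iffD1, rotated]) (simp add: T_def hitting_eq space_\<mu>)
qed

lemma T_cong:
  assumes "\<And>g x. x \<in> space X \<Longrightarrow> F (g, x) = F' (g, x)" "x \<in> space X"
  shows "T F x = T F' x"
  unfolding T_def fiber_def orbit_def using assms by (simp add: act_space)

lemma T_cmult:
  assumes "F \<in> borel_measurable (borel \<Otimes>\<^sub>M \<mu>)" "x \<in> space X"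
  shows "T (\<lambda>z. c * F z) x = c * T F x"
proof -
  have "fiber (\<lambda>z. c * F z) (g, x) = c * fiber F (g, x)" for g
    using assms nn_integral_cmult[OF orbit_measurable, of F x c g] by (simp add: fiber_def orbit_def)
  then show ?thesis by (simp add: T_def nn_integral_cmult)
qed

lemma T_add:
  assumes "F \<in> borel_measurable (borel \<Otimes>\<^sub>M \<mu>)" "F' \<in> borel_measurable (borel \<Otimes>\<^sub>M \<mu>)" "x \<in> space X"
  shows "T (\<lambda>z. F z + F' z) x = T F x + T F' x"
proof -
  have "fiber (\<lambda>z. F z + F' z) (g, x) = fiber F (g, x) + fiber F' (g, x)" for g
    using assms nn_integral_add[OF orbit_measurable orbit_measurable, of F x F' x g g]
    by (simp add: fiber_def orbit_def)
  then show ?thesis by (simp add: T_def nn_integral_add)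
qed

lemma T_suminf:
  fixes F :: "nat \<Rightarrow> 'g \<times> 'x \<Rightarrow> ennreal"
  assumes "\<And>i. F i \<in> borel_measurable (borel \<Otimes>\<^sub>M \<mu>)" "x \<in> space X"
  shows "T (\<lambda>z. \<Sum>i. F i z) x = (\<Sum>i. T (F i) x)"
proof -
  have "fiber (\<lambda>z. \<Sum>i. F i z) (g, x) = (\<Sum>i. fiber (F i) (g, x))" for g
  proof -
    have "fiber (\<lambda>z. \<Sum>i. F i z) (g, x) = (\<integral>\<^sup>+h. (\<Sum>i. orbit (F i) (g, x) h) \<partial>mH)"
      by (simp add: fiber_def orbit_def)
    also have "\<dots> = (\<Sum>i. fiber (F i) (g, x))"
      unfolding fiber_def by (intro nn_integral_suminf orbit_measurable assms)
    finally show ?thesis .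
  qed
  then show ?thesis by (simp add: T_def nn_integral_suminf)
qed

lemma T_SUP:
  fixes F :: "nat \<Rightarrow> 'g \<times> 'x \<Rightarrow> ennreal"
  assumes "\<And>i. F i \<in> borel_measurable (borel \<Otimes>\<^sub>M \<mu>)" "incseq F" "x \<in> space X"
  shows "T (\<lambda>z. SUP i. F i z) x = (SUP i. T (F i) x)"
proof -
  have "incseq (\<lambda>i. orbit (F i) z)" for z
    using assms(2) by (auto simp: orbit_def incseq_def le_fun_def)
  note inc = this
  have eq: "fiber (\<lambda>z. SUP i. F i z) (g, x) = (SUP i. fiber (F i) (g, x))" for g
    using nn_integral_monotone_convergence_SUP[OF inc[of "(g, x)"] orbit_measurable[OF assms(1,3)]]
    by (simp add: fiber_def orbit_def)
  have "incseq (\<lambda>i. fiber (F i) z)" for z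
    unfolding fiber_def incseq_def
    using inc[of z] by (auto intro!: nn_integral_mono simp: incseq_def le_fun_def)
  then have "incseq (\<lambda>i C. fiber (F i) (coset_rep C, x))"
    by (auto simp: incseq_def le_fun_def)
  from nn_integral_monotone_convergence_SUP[OF this] show ?thesis
    by (simp add: T_def eq)
qed

lemma T_mono: "(\<And>z. F z \<le> F' z) \<Longrightarrow> T F x \<le> T F' x"
  unfolding T_def fiber_def orbit_def by (intro nn_integral_mono)

text \<open>The Campbell measure of the system. The completion appears because \<open>T\<close> of a
  Borel indicator is measurable through projections, hence only for the completion.\<close>

definition \<nu> :: "('g \<times> 'x) measure" where
  "\<nu> = measure_of (space (borel \<Otimes>\<^sub>M \<mu>)) (sets (borel \<Otimes>\<^sub>M \<mu>)) (\<lambda>B. \<integral>\<^sup>+x. T (indicator B) x \<partial>completion \<mu>)"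

lemma sets_\<nu> [measurable_cong, simp]: "sets \<nu> = sets (borel \<Otimes>\<^sub>M \<mu>)"
  by (simp add: \<nu>_def)

lemma space_\<nu>: "space \<nu> = UNIV \<times> space X"
  using sets_eq_imp_space_eq[OF sets_\<nu>] by (simp add: space_pair_measure space_\<mu>)

lemma emeasure_\<nu>:
  assumes "B \<in> sets (borel \<Otimes>\<^sub>M \<mu>)"
  shows "emeasure \<nu> B = (\<integral>\<^sup>+x. T (indicator B) x \<partial>completion \<mu>)"
proof (rule emeasure_measure_of[OF \<nu>_def])
  show "positive (sets \<nu>) (\<lambda>B. \<integral>\<^sup>+x. T (indicator B) x \<partial>completion \<mu>)"
    by (simp add: positive_def T_def fiber_def orbit_def)
  show "countably_additive (sets \<nu>) (\<lambda>B. \<integral>\<^sup>+x. T (indicator B) x \<partial>completion \<mu>)"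
  proof (rule countably_additiveI)
    fix A :: "nat \<Rightarrow> _" assume A: "range A \<subseteq> sets \<nu>" "disjoint_family A"
    then have [measurable]: "A i \<in> sets (borel \<Otimes>\<^sub>M \<mu>)" for i by auto
    have "indicator (\<Union>i. A i) = (\<lambda>z. \<Sum>i. indicator (A i) z :: ennreal)"
      using suminf_indicator[OF A(2)] by (intro ext) simp
    then have "(\<integral>\<^sup>+x. T (indicator (\<Union>i. A i)) x \<partial>completion \<mu>) =
        (\<integral>\<^sup>+x. (\<Sum>i. T (indicator (A i)) x) \<partial>completion \<mu>)"
      by (intro nn_integral_cong) (simp add: T_suminf space_\<mu>)
    also have "\<dots> = (\<Sum>i. \<integral>\<^sup>+x. T (indicator (A i)) x \<partial>completion \<mu>)"
      by (intro nn_integral_suminf) measurable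
    finally show "(\<Sum>i. \<integral>\<^sup>+x. T (indicator (A i)) x \<partial>completion \<mu>) =
        (\<integral>\<^sup>+x. T (indicator (\<Union>i. A i)) x \<partial>completion \<mu>)" by simp
  qed
qed (use assms sets.space_closed in auto)

lemma nn_integral_\<nu>:
  assumes "F \<in> borel_measurable (borel \<Otimes>\<^sub>M \<mu>)"
  shows "(\<integral>\<^sup>+z. F z \<partial>\<nu>) = (\<integral>\<^sup>+x. T F x \<partial>completion \<mu>)"
  using assms
proof (induction F rule: borel_measurable_induct)
  case (cong F F')
  then have "(\<integral>\<^sup>+z. F z \<partial>\<nu>) = (\<integral>\<^sup>+z. F' z \<partial>\<nu>)"
    by (intro nn_integral_cong) (simp add: space_\<nu> space_pair_measure space_\<mu>)
  moreover have "(\<integral>\<^sup>+x. T F x \<partial>completion \<mu>) = (\<integral>\<^sup>+x. T F' x \<partial>completion \<mu>)"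
    using cong by (intro nn_integral_cong T_cong) (auto simp: space_pair_measure space_\<mu>)
  ultimately show ?case using cong by simp
next
  case (set B)
  then show ?case by (simp add: emeasure_\<nu>)
next
  case (mult F c)
  have "(\<integral>\<^sup>+x. T (\<lambda>z. c * F z) x \<partial>completion \<mu>) = (\<integral>\<^sup>+x. c * T F x \<partial>completion \<mu>)"
    using mult by (intro nn_integral_cong T_cmult) (auto simp: space_\<mu>)
  then show ?case using mult by (simp add: nn_integral_cmult)
next
  case (add F F')
  have "(\<integral>\<^sup>+x. T (\<lambda>z. F z + F' z) x \<partial>completion \<mu>) = (\<integral>\<^sup>+x. T F x + T F' x \<partial>completion \<mu>)"
    using add by (intro nn_integral_cong T_add) (auto simp: space_\<mu>)
  then show ?case using add by (simp add: nn_integral_add add.commute)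
next
  case (seq U)
  have "(\<integral>\<^sup>+z. (SUP i. U i z) \<partial>\<nu>) = (SUP i. \<integral>\<^sup>+z. U i z \<partial>\<nu>)"
    using seq by (intro nn_integral_monotone_convergence_SUP) auto
  also have "\<dots> = (SUP i. \<integral>\<^sup>+x. T (U i) x \<partial>completion \<mu>)"
    using seq by simp
  also have "\<dots> = (\<integral>\<^sup>+x. (SUP i. T (U i) x) \<partial>completion \<mu>)"
  proof (rule nn_integral_monotone_convergence_SUP[symmetric])
    show "incseq (\<lambda>i. T (U i))"
      using seq(3) by (auto simp: incseq_def le_fun_def intro!: T_mono)
  qed (use seq in measurable)
  also have "\<dots> = (\<integral>\<^sup>+x. T (\<lambda>z. SUP i. U i z) x \<partial>completion \<mu>)"
    using seq by (intro nn_integral_cong T_SUP[symmetric]) (auto simp: space_\<mu>)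
  finally show ?case by (simp add: image_comp SUP_apply[abs_def])
qed

section \<open>Disintegration\<close>

lemma rcoset_coset_rep: "rcoset H (coset_rep (rcoset H g)) = rcoset H g"
  using coset_rep_rcoset[OF subgroup_H, of g] rcoset_plus[OF subgroup_H] by metis

lemma hitting_rep:
  assumes "C \<in> hitting H act Y x" "x \<in> space X"
  shows "rcoset H (coset_rep C) = C" and "h \<in> H \<Longrightarrow> act (h + coset_rep C) x \<in> Y"
proof -
  obtain g where g: "C = rcoset H g" "act g x \<in> Y"
    using assms(1) by (auto simp: hitting_def)
  obtain h' where h': "h' \<in> H" "coset_rep C = h' + g"
    using coset_rep_rcoset[OF subgroup_H, of g] g(1) by metis
  show "rcoset H (coset_rep C) = C"
    unfolding g(1) by (rule rcoset_coset_rep)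
  show "act (h + coset_rep C) x \<in> Y" if "h \<in> H"
    using that h' g(2) assms(2) by (simp add: act_add H_act_Y act_space)
qed

text \<open>A coset that misses the inverses of \<open>K\<close> contributes nothing. Any other has
  a representative \<open>- k\<close> with \<open>k \<in> K\<close>, and then the integrand can be
  nonzero only for \<open>h\<close> in \<open>- K + K\<close>. The bound is therefore the Haar
  measure of the part of \<open>- K + K\<close> in \<open>H\<close>, uniformly in \<open>g\<close>
  and \<open>x\<close>.\<close>

lemma fiber_indicator_le:
  assumes K: "compact K" and x: "x \<in> space X"
  shows "fiber (indicator (K \<times> space X)) (g, x) \<le>
    emeasure mH ((\<lambda>(a, b). a + b) ` (uminus ` K \<times> K) \<inter> H) * indicator (rcoset H ` uminus ` K) (rcoset H g)"
    (is "_ \<le> emeasure mH ?S * _")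
proof -
  let ?F = "indicator (K \<times> space X) :: _ \<Rightarrow> ennreal"
  have "space X \<in> sets \<mu>" using sets.top[of \<mu>] by (simp add: space_\<mu>)
  then have [measurable]: "?F \<in> borel_measurable (borel \<Otimes>\<^sub>M \<mu>)"
    using borel_closed[OF compact_imp_closed[OF K]] by measurable
  have S: "?S \<in> sets mH"
    unfolding sets_mH sets_restrict_space
    using compact_plus[OF compact_uminus[OF K] K]
    by (subst Int_commute) (intro imageI borel_closed compact_imp_closed)
  show ?thesis
  proof (cases "rcoset H g \<in> rcoset H ` uminus ` K")
    case True
    then obtain k where k: "k \<in> K" "rcoset H g = rcoset H (- k)" by blast
    then have "g - - k \<in> H" using rcoset_eq_iff[OF subgroup_H] by blast
    then have "fiber ?F (g, x) = fiber ?F (- k, x)"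
      using fiber_invariant[of ?F "g - - k" x "- k"] x by (simp add: add.assoc)
    also have "\<dots> \<le> (\<integral>\<^sup>+h. indicator ?S h \<partial>mH)"
      unfolding fiber_def
    proof (rule nn_integral_mono)
      fix h assume "h \<in> space mH"
      then have h: "h \<in> H" by (simp add: space_mH)
      have "h \<in> ?S" if "- (h + - k) \<in> K"
      proof -
        have "h = - (- (h + - k)) + k" by (simp add: add.assoc)
        moreover have "(- (- (h + - k)), k) \<in> uminus ` K \<times> K"
          using that k(1) by blast
        ultimately have "h \<in> (\<lambda>(a, b). a + b) ` (uminus ` K \<times> K)"
          by (metis (no_types, lifting) case_prod_conv image_eqI)
        with h show ?thesis by blast
      qed
      then show "orbit ?F (- k, x) h \<le> indicator ?S h"
        by (auto simp: orbit_def indicator_def)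
    qed
    also have "\<dots> = emeasure mH ?S" using S by simp
    finally show ?thesis using True by simp
  next
    case False
    have "orbit ?F (g, x) h = 0" if "h \<in> H" for h
    proof -
      have "- (h + g) \<notin> K"
      proof
        assume "- (h + g) \<in> K"
        moreover have "rcoset H g = rcoset H (- (- (h + g)))"
          using rcoset_plus[OF subgroup_H that] by simp
        ultimately show False using False by blast
      qed
      then show ?thesis by (simp add: orbit_def)
    qed
    then have "fiber ?F (g, x) = (\<integral>\<^sup>+h. 0 \<partial>mH)"
      unfolding fiber_def by (intro nn_integral_cong) (simp add: space_mH)
    then show ?thesis by simp
  qed
qed

lemma fiber_bound_finite:
  assumes K: "compact K"
  shows "emeasure mH ((\<lambda>(a, b). a + b) ` (uminus ` K \<times> K) \<inter> H) < \<infinity>"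
proof -
  have "compact ((\<lambda>(a, b). a + b) ` (uminus ` K \<times> K) \<inter> H)"
    using compact_plus[OF compact_uminus[OF K] K] closed_H by (rule compact_Int_closed)
  then show ?thesis using haar_H by (auto simp: haar_measure_def)
qed

text \<open>The cosets meeting \<open>K\<close> are those of the points of \<open>H + K\<close>, a
  Borel set, so \<open>Z\<close> can be restricted to it before the cosets are counted.\<close>

lemma count_measurable:
  assumes K: "compact K"
  shows "(\<lambda>x. emeasure (count_space UNIV) (hitting H act Y x \<inter> rcoset H ` K)) \<in> borel_measurable (completion \<mu>)"
proof -
  let ?HK = "(\<lambda>(a, b). a + b) ` (H \<times> K)"
  have "?HK \<in> sets borel" by (rule closed_plus_compact_borel[OF lc closed_H K])
  then have "Z \<inter> ?HK \<times> space \<mu> \<in> sets (borel \<Otimes>\<^sub>M \<mu>)" by measurable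
  from borel_measurable_coset_count[OF lc subgroup_H closed_H finite_measure_axioms this]
  show ?thesis
  proof (rule measurable_cong[THEN iffD1, rotated])
    fix x assume "x \<in> space (completion \<mu>)"
    then have x: "x \<in> space X" by (simp add: space_\<mu>)
    have "g \<in> ?HK \<longleftrightarrow> rcoset H g \<in> rcoset H ` K" for g
    proof
      assume "g \<in> ?HK"
      then obtain h k where "h \<in> H" "k \<in> K" "g = h + k" by auto
      then show "rcoset H g \<in> rcoset H ` K" using rcoset_plus[OF subgroup_H] by blast
    next
      assume "rcoset H g \<in> rcoset H ` K"
      then obtain k where "k \<in> K" "g - k \<in> H" using rcoset_eq_iff[OF subgroup_H] by blast
      then show "g \<in> ?HK" by (intro image_eqI[of _ _ "(g - k, k)"]) auto
    qed
    then have "rcoset H ` {g. (g, x) \<in> Z \<inter> ?HK \<times> space \<mu>} = hitting H act Y x \<inter> rcoset H ` K"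
      unfolding hitting_eq[OF x] using x by (auto simp: space_\<mu>)
    then show "emeasure (count_space UNIV) (rcoset H ` {g. (g, x) \<in> Z \<inter> ?HK \<times> space \<mu>}) =
        emeasure (count_space UNIV) (hitting H act Y x \<inter> rcoset H ` K)" by simp
  qed
qed

lemma count_integral_finite:
  assumes "compact K"
  shows "(\<integral>\<^sup>+x. emeasure (count_space UNIV) (hitting H act Y x \<inter> rcoset H ` K) \<partial>completion \<mu>) < \<infinity>"
  using integrable_sys compactin_coset_image[OF assms, of H]
  by (simp add: integrable_transverse_system_def nn_integral_completion)

text \<open>A count with finite integral is finite almost everywhere. At such points the
  periodization of a function supported over a compact set is a finite sum.\<close>

lemma AE_finite_hitting:
  assumes "compact K"
  shows "AE x in completion \<mu>. finite (hitting H act Y x \<inter> rcoset H ` K)"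
proof -
  have "AE x in completion \<mu>. emeasure (count_space UNIV) (hitting H act Y x \<inter> rcoset H ` K) \<noteq> \<infinity>"
    using count_measurable[OF assms] count_integral_finite[OF assms]
    by (intro nn_integral_PInf_AE) auto
  then show ?thesis
    by (rule AE_mp) (auto simp: emeasure_count_space split: if_splits)
qed

lemma T_indicator_le:
  assumes K: "compact K" and x: "x \<in> space X"
  shows "T (indicator (K \<times> space X)) x \<le>
    emeasure mH ((\<lambda>(a, b). a + b) ` (uminus ` K \<times> K) \<inter> H) *
    emeasure (count_space UNIV) (hitting H act Y x \<inter> rcoset H ` uminus ` K)"
    (is "_ \<le> ?c * emeasure _ (?S \<inter> ?L)")
proof -
  have "T (indicator (K \<times> space X)) x \<le> (\<integral>\<^sup>+C. ?c * indicator (?S \<inter> ?L) C \<partial>count_space ?S)"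
    unfolding T_def
  proof (rule nn_integral_mono)
    fix C assume "C \<in> space (count_space ?S)"
    then show "fiber (indicator (K \<times> space X)) (coset_rep C, x) \<le> ?c * indicator (?S \<inter> ?L) C"
      using fiber_indicator_le[OF K x, of "coset_rep C"] hitting_rep(1)[OF _ x, of C]
      by (simp add: indicator_def)
  qed
  also have "\<dots> = ?c * emeasure (count_space ?S) (?S \<inter> ?L)"
    by (simp add: nn_integral_cmult)
  also have "emeasure (count_space ?S) (?S \<inter> ?L) = emeasure (count_space UNIV) (?S \<inter> ?L)"
    by (simp add: emeasure_count_space)
  finally show ?thesis .
qed

text \<open>Integrability of the system bounds the expected number of cosets, and the uniform fiber
  bound multiplies it. This finiteness makes the slices of \<nu> sigma-finite and bounded functions
  supported over \<open>K\<close> integrable.\<close>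

lemma emeasure_\<nu>_compact:
  assumes K: "compact K"
  shows "emeasure \<nu> (K \<times> space X) < \<infinity>"
proof -
  let ?c = "emeasure mH ((\<lambda>(a, b). a + b) ` (uminus ` K \<times> K) \<inter> H)"
  let ?N = "\<lambda>x. emeasure (count_space UNIV) (hitting H act Y x \<inter> rcoset H ` uminus ` K)"
  have "space X \<in> sets \<mu>" using sets.top[of \<mu>] by (simp add: space_\<mu>)
  from pair_measureI[OF borel_closed[OF compact_imp_closed[OF K]] this]
  have "emeasure \<nu> (K \<times> space X) = (\<integral>\<^sup>+x. T (indicator (K \<times> space X)) x \<partial>completion \<mu>)"
    by (rule emeasure_\<nu>)
  also have "\<dots> \<le> (\<integral>\<^sup>+x. ?c * ?N x \<partial>completion \<mu>)"
    by (intro nn_integral_mono T_indicator_le K) (simp add: space_\<mu>)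
  also have "\<dots> = ?c * (\<integral>\<^sup>+x. ?N x \<partial>completion \<mu>)"
    using count_measurable[OF compact_uminus[OF K]] by (rule nn_integral_cmult)
  also have "\<dots> < \<infinity>"
    using count_integral_finite[OF compact_uminus[OF K]] fiber_bound_finite[OF K]
    by (simp add: ennreal_mult_less_top)
  finally show ?thesis .
qed

text \<open>Since \<open>g.x\<close> equals the image of \<open>a.x\<close> under
  \<open>g - a\<close>, the hitting set of \<open>a.x\<close> is that of \<open>x\<close> translated
  on the right by \<open>- a\<close>. Under this reindexing the inverse of a point of the coset
  acquires the factor \<open>a\<close> on the left.\<close>

lemma T_translate:
  assumes F [measurable]: "F \<in> borel_measurable (borel \<Otimes>\<^sub>M \<mu>)" and x: "x \<in> space X"
  shows "T (\<lambda>z. F (a + fst z, snd z)) x = T F (act a x)"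
proof -
  \<comment> \<open>Right translation by \<open>- a\<close> on cosets, written through
    representatives; \<open>diff\<close> shows that it respects and reflects equality of
    cosets.\<close>
  define \<phi> where "\<phi> C = rcoset H (coset_rep C - a)" for C
  have diff: "(g - a) - (g' - a) = g - g'" for g g'
  proof -
    have "(g - a) - (g' - a) = (g - a) + (a - g')"
      by (simp only: diff_conv_add_uminus[of "g - a"] minus_diff_eq)
    then show ?thesis by (simp add: add_diff_eq)
  qed
  have \<phi>: "\<phi> (rcoset H g) = rcoset H (g - a)" for g
    using rcoset_coset_rep[of g]
    unfolding \<phi>_def rcoset_eq_iff[OF subgroup_H] diff .
  have "bij_betw \<phi> (hitting H act Y x) (hitting H act Y (act a x))"
  proof (rule bij_betw_imageI)
    show "inj_on \<phi> (hitting H act Y x)"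
    proof -
      have "rcoset H (g - a) = rcoset H (g' - a) \<longleftrightarrow> rcoset H g = rcoset H g'" for g g'
        unfolding rcoset_eq_iff[OF subgroup_H] diff ..
      then show ?thesis by (auto simp: inj_on_def hitting_def \<phi>)
    qed
    have "rcoset H g \<in> \<phi> ` hitting H act Y x" if "act g (act a x) \<in> Y" for g
    proof (rule image_eqI)
      show "rcoset H g = \<phi> (rcoset H (g + a))" by (simp add: \<phi>)
      show "rcoset H (g + a) \<in> hitting H act Y x"
        using that x by (auto simp: hitting_def act_add)
    qed
    then have "hitting H act Y (act a x) \<subseteq> \<phi> ` hitting H act Y x"
      by (auto simp: hitting_def)
    moreover have "\<phi> ` hitting H act Y x \<subseteq> hitting H act Y (act a x)"
    proof
      fix C assume "C \<in> \<phi> ` hitting H act Y x"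
      then obtain g where "C = rcoset H (g - a)" "act g x \<in> Y"
        by (auto simp: hitting_def \<phi>)
      moreover have "act (g - a) (act a x) = act g x"
        using x by (simp add: act_add[symmetric])
      ultimately show "C \<in> hitting H act Y (act a x)"
        unfolding hitting_def mem_Collect_eq by (intro exI[of _ "g - a"] conjI) simp_all
    qed
    ultimately show "\<phi> ` hitting H act Y x = hitting H act Y (act a x)"
      by blast
  qed
  then have "T F (act a x) = (\<integral>\<^sup>+C. fiber F (coset_rep (\<phi> C), act a x) \<partial>count_space (hitting H act Y x))"
    unfolding T_def by (rule nn_integral_bij_count_space[symmetric])
  also have "\<dots> = T (\<lambda>z. F (a + fst z, snd z)) x"
    unfolding T_def
  proof (rule nn_integral_cong)
    fix C
    have "fiber F (coset_rep (\<phi> C), act a x) = fiber F (coset_rep C - a, act a x)"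
      unfolding \<phi>_def using x by (intro fiber_coset_rep F act_space)
    moreover have "act (h + (coset_rep C - a)) (act a x) = act (h + coset_rep C) x" for h
      using x by (simp add: act_add[symmetric] add.assoc)
    moreover have "- (h + (coset_rep C - a)) = a + - (h + coset_rep C)" for h
      by (simp add: minus_add add_diff_eq diff_add_eq_diff_diff_swap)
    ultimately show "fiber F (coset_rep (\<phi> C), act a x) =
        fiber (\<lambda>z. F (a + fst z, snd z)) (coset_rep C, x)"
      by (simp add: fiber_def orbit_def)
  qed
  finally show ?thesis ..
qed

text \<open>The function is replaced by a version measurable for \<mu>. Invariance of \<mu> also
  ensures that the exceptional null set stays null after translation by \<open>a\<close>.\<close>

lemma nn_integral_act:
  assumes "f \<in> borel_measurable (completion \<mu>)"
  shows "(\<integral>\<^sup>+x. f (act a x) \<partial>completion \<mu>) = (\<integral>\<^sup>+x. f x \<partial>completion \<mu>)"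
proof -
  obtain f' where [measurable]: "f' \<in> borel_measurable \<mu>" and ae: "AE x in \<mu>. f x = f' x"
    using completion_ex_borel_measurable[OF assms] by blast
  have [measurable]: "act a \<in> \<mu> \<rightarrow>\<^sub>M \<mu>" by measurable
  have "AE x in distr \<mu> \<mu> (act a). f x = f' x"
    unfolding distr_act by (rule ae)
  then have ae': "AE x in \<mu>. f (act a x) = f' (act a x)"
    by (rule AE_distrD[rotated]) measurable
  have "(\<integral>\<^sup>+x. f' (act a x) \<partial>\<mu>) = (\<integral>\<^sup>+x. f' x \<partial>\<mu>)"
    using nn_integral_distr[of "act a" \<mu> \<mu> f'] by (simp add: distr_act)
  then show ?thesis
    using nn_integral_cong_AE[OF ae] nn_integral_cong_AE[OF ae'] by (simp add: nn_integral_completion)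
qed

lemma \<nu>_translate:
  assumes [measurable]: "E \<in> sets borel" "A \<in> sets \<mu>"
  shows "emeasure \<nu> ((\<lambda>g. a + g) -` E \<times> A) = emeasure \<nu> (E \<times> A)"
proof -
  have [measurable]: "(\<lambda>g. a + g) -` E \<in> sets borel"
    using measurable_sets_borel[of "\<lambda>g. a + g" borel E] by simp
  have "indicator ((\<lambda>g. a + g) -` E \<times> A) =
      (\<lambda>z. indicator (E \<times> A) (a + fst z, snd z) :: ennreal)"
    by (auto simp: indicator_def)
  then have "emeasure \<nu> ((\<lambda>g. a + g) -` E \<times> A) =
      (\<integral>\<^sup>+x. T (\<lambda>z. indicator (E \<times> A) (a + fst z, snd z)) x \<partial>completion \<mu>)"
    by (simp add: emeasure_\<nu>)
  also have "\<dots> = (\<integral>\<^sup>+x. T (indicator (E \<times> A)) (act a x) \<partial>completion \<mu>)"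
    by (intro nn_integral_cong T_translate) (simp_all add: space_\<mu>)
  also have "\<dots> = emeasure \<nu> (E \<times> A)"
    by (simp add: nn_integral_act emeasure_\<nu>)
  finally show ?thesis .
qed

section \<open>Slices of the Campbell measure and the product decomposition\<close>

definition slice :: "'x set \<Rightarrow> 'g measure" where
  "slice A = distr (density \<nu> (indicator (UNIV \<times> A))) borel fst"

lemma sets_slice [measurable_cong, simp]: "sets (slice A) = sets borel"
  by (simp add: slice_def)

lemma emeasure_slice:
  assumes [measurable]: "E \<in> sets borel" "A \<in> sets \<mu>"
  shows "emeasure (slice A) E = emeasure \<nu> (E \<times> A)"
proof -
  have "UNIV \<times> A \<in> sets \<nu>" by simp
  then have [measurable]: "(indicator (UNIV \<times> A) :: _ \<Rightarrow> ennreal) \<in> borel_measurable \<nu>"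
    by (rule borel_measurable_indicator)
  have "emeasure (slice A) E = emeasure (density \<nu> (indicator (UNIV \<times> A))) (fst -` E \<inter> space \<nu>)"
    by (simp add: slice_def emeasure_distr)
  also have "\<dots> = (\<integral>\<^sup>+z. indicator (UNIV \<times> A) z * indicator (fst -` E \<inter> space \<nu>) z \<partial>\<nu>)"
    by (rule emeasure_density) measurable
  also have "\<dots> = (\<integral>\<^sup>+z. indicator (E \<times> A) z \<partial>\<nu>)"
    by (intro nn_integral_cong) (auto simp: indicator_def)
  finally show ?thesis by simp
qed

lemma slice_compact:
  assumes K: "compact K" and A: "A \<in> sets \<mu>"
  shows "emeasure (slice A) K < \<infinity>"
proof -
  have [measurable]: "K \<in> sets borel" using K by (intro borel_closed compact_imp_closed)
  have "space X \<in> sets \<mu>" using sets.top[of \<mu>] by (simp add: space_\<mu>)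
  then have "emeasure (slice A) K \<le> emeasure \<nu> (K \<times> space X)"
    using A sets.sets_into_space[OF A]
    by (subst emeasure_slice) (auto intro!: emeasure_mono simp: space_\<mu>)
  then show ?thesis using emeasure_\<nu>_compact[OF K] by (rule le_less_trans)
qed

lemma slice_left:
  assumes A: "A \<in> sets \<mu>"
  shows "distr (slice A) (slice A) (\<lambda>g. a + g) = slice A"
proof (rule measure_eqI)
  fix E assume "E \<in> sets (distr (slice A) (slice A) (\<lambda>g. a + g))"
  then have E: "E \<in> sets borel" by simp
  then have "(\<lambda>g. a + g) -` E \<in> sets borel"
    using measurable_sets_borel[of "\<lambda>g. a + g" borel E] by simp
  moreover have "space (slice A) = UNIV" by (simp add: slice_def)
  ultimately show "emeasure (distr (slice A) (slice A) (\<lambda>g. a + g)) E = emeasure (slice A) E"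
    using E A by (simp add: emeasure_distr emeasure_slice \<nu>_translate)
qed simp

text \<open>A nonzero slice is left invariant and finite on compact sets, hence a Haar measure of
  \<open>G\<close>, and unimodularity applies. The zero slice is treated apart because a Haar
  measure is required to be nonzero.\<close>

lemma slice_right:
  assumes A: "A \<in> sets \<mu>"
  shows "distr (slice A) (slice A) (\<lambda>g. g + a) = slice A"
proof (cases "emeasure (slice A) UNIV = 0")
  case True
  have null: "emeasure (slice A) E = 0" for E
    using emeasure_space[of "slice A" E] True by (simp add: slice_def)
  show ?thesis
    by (rule measure_eqI) (simp_all add: emeasure_distr null)
next
  case False
  then have "haar_measure UNIV (slice A)"
    using slice_left[OF A] slice_compact[OF _ A] by (simp add: haar_measure_def)
  with uniG show ?thesis by (simp add: unimodular_def)
qed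

lemma mG_right: "distr mG mG (\<lambda>g. g + a) = mG"
  using uniG haar_G by (simp add: unimodular_def)

lemma slice_sigma_finite:
  assumes A: "A \<in> sets \<mu>"
  shows "sigma_finite_measure (slice A)"
proof -
  obtain L :: "nat \<Rightarrow> 'g set" where L: "\<And>n. compact (L n)" "UNIV = (\<Union>n. L n)"
    using open_eq_countable_Union_compact[OF lc open_UNIV] by blast
  have sub: "range L \<subseteq> sets (slice A)"
    using compact_imp_closed[OF L(1)] by auto
  have fin: "\<forall>a\<in>range L. emeasure (slice A) a \<noteq> \<infinity>"
    using slice_compact[OF L(1) A] by (auto dest: less_imp_neq)
  have cover: "\<Union>(range L) = space (slice A)"
    unfolding L(2)[symmetric] by (simp add: slice_def)
  have "countable (range L)" by simp
  then show ?thesis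
    using fin sub cover by (intro sigma_finite_measure.intro exI conjI)
qed

text \<open>On rectangles the product formula is the proportionality of \<open>slice A\<close> and
  \<open>mG\<close>; both measures being sigma-finite, rectangles determine the product.\<close>

lemma disintegration:
  obtains \<sigma> where "sets \<sigma> = sets \<mu>" "finite_measure \<sigma>" "mG \<Otimes>\<^sub>M \<sigma> = \<nu>"
proof -
  obtain K where K: "compact K" "0 < emeasure mG K" "emeasure mG K < \<infinity>"
    using haar_measure_compact_pos[OF lc haar_G] .
  have K_borel: "K \<in> sets borel" "uminus ` K \<in> sets borel"
    by (intro borel_closed compact_imp_closed compact_uminus K(1))+
  note [measurable] = this
  have X: "space X \<in> sets \<mu>" using sets.top[of \<mu>] by (simp add: space_\<mu>)
  \<comment> \<open>Proportionality forces this normalization, with the inverses of \<open>K\<close>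
    above and \<open>mG K\<close> below. Defining it as a rescaled image of a restriction of \<nu>
    makes it a measure in \<open>A\<close> by construction.\<close>
  define \<sigma> where "\<sigma> = scale_measure (1 / emeasure mG K)
    (distr (density \<nu> (indicator (uminus ` K \<times> space X))) \<mu> snd)"
  have [measurable]: "uminus ` K \<times> space X \<in> sets (borel \<Otimes>\<^sub>M \<mu>)" using X by measurable
  have sets: "sets \<sigma> = sets \<mu>" by (simp add: \<sigma>_def)
  have \<sigma>: "emeasure \<sigma> A = emeasure (slice A) (uminus ` K) / emeasure mG K" if [measurable]: "A \<in> sets \<mu>" for A
  proof -
    have "uminus ` K \<times> space X \<in> sets \<nu>" by simp
    then have [measurable]: "(indicator (uminus ` K \<times> space X) :: _ \<Rightarrow> ennreal) \<in> borel_measurable \<nu>"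
      by (rule borel_measurable_indicator)
    have "emeasure (distr (density \<nu> (indicator (uminus ` K \<times> space X))) \<mu> snd) A =
        emeasure (density \<nu> (indicator (uminus ` K \<times> space X))) (snd -` A \<inter> space \<nu>)"
      by (simp add: emeasure_distr)
    also have "\<dots> = (\<integral>\<^sup>+z. indicator (uminus ` K \<times> space X) z * indicator (snd -` A \<inter> space \<nu>) z \<partial>\<nu>)"
      by (rule emeasure_density) measurable
    also have "\<dots> = (\<integral>\<^sup>+z. indicator (uminus ` K \<times> A) z \<partial>\<nu>)"
      using sets.sets_into_space[OF that]
      by (intro nn_integral_cong) (auto simp: indicator_def space_\<mu>)
    also have "\<dots> = emeasure (slice A) (uminus ` K)"
      using that by (simp add: emeasure_slice)
    finally show ?thesis
      by (simp add: \<sigma>_def divide_ennreal_def mult.commute)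
  qed
  have fin: "finite_measure \<sigma>"
  proof (rule finite_measureI)
    have "space \<sigma> = space X" using sets_eq_imp_space_eq[OF sets] by (simp add: space_\<mu>)
    then show "emeasure \<sigma> (space \<sigma>) \<noteq> \<infinity>"
      using \<sigma>[OF X] slice_compact[OF compact_uminus[OF K(1)] X] K(2)
      by (simp add: ennreal_divide_eq_top_iff less_top[symmetric] zero_less_iff_neq_zero)
  qed
  have "mG \<Otimes>\<^sub>M \<sigma> = \<nu>"
  proof (rule pair_measure_eqI)
    show "sigma_finite_measure mG" by unfold_locales
    show "sigma_finite_measure \<sigma>" using fin by (rule finite_measure.axioms)
    show "sets (mG \<Otimes>\<^sub>M \<sigma>) = sets \<nu>"
      by (simp add: sets sets_mG cong: sets_pair_measure_cong)
    fix E A assume "E \<in> sets mG" "A \<in> sets \<sigma>"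
    then have EA: "E \<in> sets borel" "A \<in> sets \<mu>" by (simp_all add: sets_mG sets)
    have "emeasure mG E * emeasure \<sigma> A = emeasure mG E * emeasure (slice A) (uminus ` K) / emeasure mG K"
      by (simp add: \<sigma>[OF EA(2)] ennreal_times_divide)
    also have "emeasure mG E * emeasure (slice A) (uminus ` K) = emeasure mG K * emeasure (slice A) E"
      using haar_measure_proportional[OF sets_mG mG.sigma_finite_measure_axioms mG_right sets_slice
          slice_sigma_finite[OF EA(2)] slice_left[OF EA(2)] slice_right[OF EA(2)] K_borel(1) EA(1)]
      by simp
    also have "emeasure mG K * emeasure (slice A) E / emeasure mG K = emeasure (slice A) E"
      using K(2,3)
      by (subst mult.commute) (simp add: ennreal_mult_divide_eq zero_less_iff_neq_zero less_top[symmetric])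
    finally show "emeasure mG E * emeasure \<sigma> A = emeasure \<nu> (E \<times> A)"
      by (simp add: emeasure_slice EA)
  qed
  with sets fin show thesis by (rule that)
qed

text \<open>Transforming \<open>(g, y)\<close> to \<open>(g - h0, act h0 y)\<close> turns the orbit
  function at \<open>h\<close> into the one at \<open>h0 + h\<close>, so left invariance of
  \<open>mH\<close> already gives equality for each fiber integral.\<close>

lemma \<nu>_H_translate:
  assumes [measurable]: "E \<in> sets borel" "A \<in> sets \<mu>" and h0: "h0 \<in> H"
  shows "emeasure \<nu> ((\<lambda>g. g + - h0) -` E \<times> (act h0 -` A \<inter> space \<mu>)) = emeasure \<nu> (E \<times> A)"
proof -
  let ?B = "(\<lambda>g. g + - h0) -` E \<times> (act h0 -` A \<inter> space \<mu>)"
  have "(\<lambda>g. g + - h0) \<in> borel_measurable borel" by measurable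
  from measurable_sets_borel[OF this, of E]
  have [measurable]: "(\<lambda>g. g + - h0) -` E \<in> sets borel"
    by simp
  have [measurable]: "act h0 -` A \<inter> space \<mu> \<in> sets \<mu>" by measurable
  have "T (indicator ?B) x = T (indicator (E \<times> A)) x" if x: "x \<in> space X" for x
  proof -
    have "fiber (indicator ?B) (g, x) = fiber (indicator (E \<times> A)) (g, x)" for g
    proof -
      have "act (h0 + h + g) x = act h0 (act (h + g) x)" for h
        using x by (simp add: act_add add.assoc)
      moreover have "- (h + g) + - h0 = - (h0 + h + g)" for h
        by (simp add: minus_add add_diff_eq diff_add_eq_diff_diff_swap)
      ultimately have "orbit (indicator ?B) (g, x) = (\<lambda>h. orbit (indicator (E \<times> A)) (g, x) (h0 + h) :: ennreal)"
        using x by (auto simp: orbit_def indicator_def act_space space_\<mu>)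
      then show ?thesis
        unfolding fiber_def using nn_integral_mH_left[OF orbit_measurable h0] x by simp
    qed
    then show ?thesis by (simp add: T_def)
  qed
  then have "(\<integral>\<^sup>+x. T (indicator ?B) x \<partial>completion \<mu>) = (\<integral>\<^sup>+x. T (indicator (E \<times> A)) x \<partial>completion \<mu>)"
    by (intro nn_integral_cong) (simp add: space_\<mu>)
  moreover have "?B \<in> sets (borel \<Otimes>\<^sub>M \<mu>)" "E \<times> A \<in> sets (borel \<Otimes>\<^sub>M \<mu>)"
    by (rule pair_measureI; fact)+
  ultimately show ?thesis
    by (simp only: emeasure_\<nu>)
qed

section \<open>Complex-valued functions\<close>

text \<open>The compact set is a parameter so that linear combinations keep the same support and the
  same null set of points with infinitely many relevant cosets.\<close>

definition test_on :: "'g set \<Rightarrow> ('g \<times> 'x \<Rightarrow> complex) \<Rightarrow> bool" where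
  "test_on K F \<longleftrightarrow> F \<in> borel_measurable (borel \<Otimes>\<^sub>M \<mu>) \<and>
     (\<exists>c. \<forall>g. \<forall>x\<in>space X. norm (F (g, x)) \<le> c) \<and>
     (\<forall>g. \<forall>x\<in>space X. g \<notin> K \<longrightarrow> F (g, x) = 0)"

abbreviation per :: "('g \<times> 'x \<Rightarrow> complex) \<Rightarrow> 'x \<Rightarrow> complex" where
  "per F \<equiv> periodization H mH act Y F"

lemma per_eq: "per F x = (\<Sum>\<^sub>\<infinity>C\<in>hitting H act Y x. \<integral>h. orbit F (coset_rep C, x) h \<partial>mH)"
  by (simp add: periodization_def orbit_def)

lemma test_on_norm_le:
  assumes "test_on K F"
  shows "\<exists>c\<ge>0. \<forall>g. \<forall>x\<in>space X. norm (F (g, x)) \<le> c * indicator (K \<times> space X) (g, x)"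
proof -
  obtain c where c: "\<forall>g. \<forall>x\<in>space X. norm (F (g, x)) \<le> c"
    using assms by (auto simp: test_on_def)
  have "norm (F (g, x)) \<le> max 0 c * indicator (K \<times> space X) (g, x)" if "x \<in> space X" for g x
  proof (cases "g \<in> K")
    case True
    then show ?thesis using c[rule_format, OF that, of g] that by simp
  next
    case False
    then show ?thesis using assms that by (simp add: test_on_def)
  qed
  then show ?thesis by (intro exI[of _ "max 0 c"]) auto
qed

lemma test_on_lincomb:
  assumes "test_on K F" "test_on K G"
  shows "test_on K (\<lambda>z. a * F z + b * G z)"
proof -
  obtain c d where c: "\<forall>g. \<forall>x\<in>space X. norm (F (g, x)) \<le> c"
    and d: "\<forall>g. \<forall>x\<in>space X. norm (G (g, x)) \<le> d"
    using assms unfolding test_on_def by blast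
  have "norm (a * F (g, x) + b * G (g, x)) \<le> norm a * c + norm b * d" if "x \<in> space X" for g x
    using c[rule_format, OF that, of g] d[rule_format, OF that, of g]
    by (intro norm_triangle_le add_mono) (auto simp: norm_mult intro!: mult_left_mono)
  then show ?thesis
    using assms unfolding test_on_def by (auto intro!: borel_measurable_add borel_measurable_times)
qed

lemma K_space_sets: "compact (K :: 'g set) \<Longrightarrow> K \<times> space X \<in> sets (borel \<Otimes>\<^sub>M \<mu>)"
  using sets.top[of \<mu>] pair_measureI[OF borel_closed[OF compact_imp_closed], of K "space \<mu>" \<mu>]
  by (simp add: space_\<mu>)

text \<open>The orbit function is dominated by a multiple of that of
  \<open>K \<times> space X\<close>, whose integral is finite by the uniform fiber bound.\<close>

lemma integrable_orbit:
  assumes K: "compact K" and F: "test_on K F" and x: "x \<in> space X"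
  shows "integrable mH (orbit F (g, x))"
  unfolding integrable_iff_bounded
proof
  show "orbit F (g, x) \<in> borel_measurable mH"
    using F x by (intro orbit_measurable) (simp_all add: test_on_def)
  obtain c where c: "0 \<le> c" "\<forall>g. \<forall>x\<in>space X. norm (F (g, x)) \<le> c * indicator (K \<times> space X) (g, x)"
    using test_on_norm_le[OF F] by blast
  have ind: "(indicator (K \<times> space X) :: _ \<Rightarrow> ennreal) \<in> borel_measurable (borel \<Otimes>\<^sub>M \<mu>)"
    using K_space_sets[OF K] by simp
  have "(\<integral>\<^sup>+h. norm (orbit F (g, x) h) \<partial>mH) \<le> (\<integral>\<^sup>+h. ennreal c * orbit (indicator (K \<times> space X)) (g, x) h \<partial>mH)"
  proof (rule nn_integral_mono)
    fix h
    have "ennreal (norm (orbit F (g, x) h)) \<le> ennreal (c * orbit (indicator (K \<times> space X)) (g, x) h)"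
      unfolding orbit_def using c(2) x by (intro ennreal_leI) (simp add: act_space)
    then show "ennreal (norm (orbit F (g, x) h)) \<le> ennreal c * orbit (indicator (K \<times> space X)) (g, x) h"
      using c(1) by (simp add: orbit_def ennreal_mult ennreal_indicator)
  qed
  also have "\<dots> = ennreal c * fiber (indicator (K \<times> space X)) (g, x)"
    unfolding fiber_def by (intro nn_integral_cmult orbit_measurable ind x)
  also have "\<dots> < \<infinity>"
  proof -
    have "fiber (indicator (K \<times> space X)) (g, x) \<le>
        emeasure mH ((\<lambda>(a, b). a + b) ` (uminus ` K \<times> K) \<inter> H) * 1"
      by (rule order_trans[OF fiber_indicator_le[OF K x]]) (intro mult_left_mono; simp add: indicator_def)
    then have "fiber (indicator (K \<times> space X)) (g, x) < \<infinity>"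
      using fiber_bound_finite[OF K] by (simp add: le_less_trans)
    then show ?thesis by (simp add: ennreal_mult_less_top)
  qed
  finally show "(\<integral>\<^sup>+h. norm (orbit F (g, x) h) \<partial>mH) < \<infinity>" .
qed

lemma orbit_eq_0:
  assumes F: "test_on K F" and x: "x \<in> space X" and C: "C \<in> hitting H act Y x"
    and "C \<notin> rcoset H ` uminus ` K" and h: "h \<in> H"
  shows "orbit F (coset_rep C, x) h = 0"
proof -
  have "- (h + coset_rep C) \<notin> K"
  proof
    assume "- (h + coset_rep C) \<in> K"
    moreover have "C = rcoset H (- (- (h + coset_rep C)))"
      using hitting_rep(1)[OF C x] rcoset_plus[OF subgroup_H h] by simp
    ultimately show False using assms(4) by blast
  qed
  then show ?thesis
    using F act_space[OF x] by (simp add: orbit_def test_on_def)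
qed

text \<open>The infinite sum takes a default value when it does not converge. At a point where
  finitely many cosets meet the inverses of \<open>K\<close>, all other terms vanish and the sum
  becomes finite, so linearity is available.\<close>

lemma per_eq_sum:
  assumes F: "test_on K F" and x: "x \<in> space X"
    and fin: "finite (hitting H act Y x \<inter> rcoset H ` uminus ` K)"
  shows "per F x = (\<Sum>C\<in>hitting H act Y x \<inter> rcoset H ` uminus ` K. \<integral>h. orbit F (coset_rep C, x) h \<partial>mH)"
proof -
  have "(\<integral>h. orbit F (coset_rep C, x) h \<partial>mH) = 0"
    if "C \<in> hitting H act Y x" "C \<notin> rcoset H ` uminus ` K" for C
    using orbit_eq_0[OF F x that] by (intro integral_eq_zero_AE AE_I2) (simp add: space_mH)
  then have "per F x = (\<Sum>\<^sub>\<infinity>C\<in>hitting H act Y x \<inter> rcoset H ` uminus ` K. \<integral>h. orbit F (coset_rep C, x) h \<partial>mH)"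
    unfolding per_eq by (intro infsum_cong_neutral) auto
  then show ?thesis using fin by simp
qed

lemma per_lincomb:
  assumes K: "compact K" and F: "test_on K F" and G: "test_on K G" and x: "x \<in> space X"
    and fin: "finite (hitting H act Y x \<inter> rcoset H ` uminus ` K)"
  shows "per (\<lambda>z. a * F z + b * G z) x = a * per F x + b * per G x"
proof -
  have "(\<integral>h. orbit (\<lambda>z. a * F z + b * G z) (g, x) h \<partial>mH) =
      a * (\<integral>h. orbit F (g, x) h \<partial>mH) + b * (\<integral>h. orbit G (g, x) h \<partial>mH)" for g
  proof -
    have "orbit (\<lambda>z. a * F z + b * G z) (g, x) = (\<lambda>h. a * orbit F (g, x) h + b * orbit G (g, x) h)"
      by (simp add: orbit_def)
    then show ?thesis
      using integrable_orbit[OF K F x] integrable_orbit[OF K G x] by simp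
  qed
  then show ?thesis
    unfolding per_eq_sum[OF test_on_lincomb[OF F G] x fin] per_eq_sum[OF F x fin] per_eq_sum[OF G x fin]
    by (simp add: sum.distrib sum_distrib_left)
qed

text \<open>The bridge between the extended nonnegative operator \<open>T\<close> and the complex
  periodization: at a good point both are the same finite sum of finite integrals.\<close>

lemma per_nonneg:
  fixes f :: "'g \<times> 'x \<Rightarrow> real"
  assumes K: "compact K" and F: "test_on K (\<lambda>z. complex_of_real (f z))" and f: "\<And>z. 0 \<le> f z"
    and x: "x \<in> space X" and fin: "finite (hitting H act Y x \<inter> rcoset H ` uminus ` K)"
  shows "\<exists>r\<ge>0. T (\<lambda>z. ennreal (f z)) x = ennreal r \<and> per (\<lambda>z. complex_of_real (f z)) x = complex_of_real r"
proof -
  let ?S = "hitting H act Y x \<inter> rcoset H ` uminus ` K"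
  let ?F = "\<lambda>z. complex_of_real (f z)"
  define I where "I C = (\<integral>h. orbit f (coset_rep C, x) h \<partial>mH)" for C
  have orbit: "orbit ?F z = (\<lambda>h. complex_of_real (orbit f z h))"
    "orbit (\<lambda>z. ennreal (f z)) z = (\<lambda>h. ennreal (orbit f z h))" for z
    by (simp_all add: orbit_def)
  have nonneg: "0 \<le> orbit f z h" for z h
    using f by (simp add: orbit_def)
  have int: "integrable mH (orbit f (g, x))" for g
    using integrable_orbit[OF K F x, of g] unfolding orbit by (simp add: complex_of_real_integrable_eq)
  have I0: "0 \<le> I C" for C
    unfolding I_def by (intro integral_nonneg_AE AE_I2 nonneg)
  have fiber: "fiber (\<lambda>z. ennreal (f z)) (coset_rep C, x) = ennreal (I C)" for C
    unfolding fiber_def orbit I_def by (intro nn_integral_eq_integral int AE_I2 nonneg)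
  have "I C = 0" if "C \<in> hitting H act Y x" "C \<notin> ?S" for C
    unfolding I_def using orbit_eq_0[OF F x that(1)] that
    by (intro integral_eq_zero_AE AE_I2) (simp add: orbit space_mH)
  then have "T (\<lambda>z. ennreal (f z)) x = (\<Sum>C\<in>?S. ennreal (I C))"
    unfolding T_def fiber using fin by (intro nn_integral_count_space') auto
  also have "\<dots> = ennreal (\<Sum>C\<in>?S. I C)"
    using I0 by (intro sum_ennreal)
  finally have "T (\<lambda>z. ennreal (f z)) x = ennreal (\<Sum>C\<in>?S. I C)" .
  moreover have "per ?F x = complex_of_real (\<Sum>C\<in>?S. I C)"
    unfolding per_eq_sum[OF F x fin] orbit I_def by simp
  ultimately show ?thesis
    using I0 by (intro exI[of _ "\<Sum>C\<in>?S. I C"]) (simp add: sum_nonneg)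
qed

section \<open>The Campbell formula for complex test functions\<close>

lemma integrable_test_on:
  assumes K: "compact K" and F: "test_on K F"
  shows "integrable \<nu> F"
proof -
  obtain c where c: "\<forall>g. \<forall>x\<in>space X. norm (F (g, x)) \<le> c * indicator (K \<times> space X) (g, x)"
    using test_on_norm_le[OF F] by blast
  show ?thesis
  proof (rule integrableI_bounded_set)
    show "K \<times> space X \<in> sets \<nu>" using K_space_sets[OF K] by simp
    show "F \<in> borel_measurable \<nu>"
      using F unfolding test_on_def measurable_cong_sets[OF sets_\<nu> refl] by blast
    show "emeasure \<nu> (K \<times> space X) < \<infinity>" by (rule emeasure_\<nu>_compact[OF K])
    show "AE z in \<nu>. z \<in> K \<times> space X \<longrightarrow> norm (F z) \<le> c"
    proof (intro AE_I2 impI)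
      fix z assume "z \<in> K \<times> space X"
      then obtain g x where "z = (g, x)" "g \<in> K" "x \<in> space X" by blast
      moreover have "norm (F (g, x)) \<le> c * indicator (K \<times> space X) (g, x)"
        using c \<open>x \<in> space X\<close> by blast
      ultimately show "norm (F z) \<le> c" by simp
    qed
    show "AE z in \<nu>. z \<notin> K \<times> space X \<longrightarrow> F z = 0"
    proof (intro AE_I2 impI)
      fix z assume "z \<in> space \<nu>" "z \<notin> K \<times> space X"
      then have "fst z \<notin> K" "snd z \<in> space X" by (auto simp: space_\<nu>)
      then have "F (fst z, snd z) = 0" using F unfolding test_on_def by blast
      then show "F z = 0" by simp
    qed
  qed
qed

lemma AE_finite_hitting_uminus:
  "compact K \<Longrightarrow> AE x in completion \<mu>. x \<in> space X \<and> finite (hitting H act Y x \<inter> rcoset H ` uminus ` K)"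
  using AE_finite_hitting[OF compact_uminus, of K] AE_space[of "completion \<mu>"]
  by (auto simp: space_\<mu>)

lemma Campbell_nonneg:
  fixes f :: "'g \<times> 'x \<Rightarrow> real"
  assumes K: "compact K" and F: "test_on K (\<lambda>z. complex_of_real (f z))" and f: "\<And>z. 0 \<le> f z"
  shows "integrable (completion \<mu>) (per (\<lambda>z. complex_of_real (f z))) \<and>
    (\<integral>x. per (\<lambda>z. complex_of_real (f z)) x \<partial>completion \<mu>) = (\<integral>z. complex_of_real (f z) \<partial>\<nu>)"
proof -
  let ?F = "\<lambda>z. complex_of_real (f z)"
  define t where "t x = enn2real (T (\<lambda>z. ennreal (f z)) x)" for x
  have fm: "f \<in> borel_measurable (borel \<Otimes>\<^sub>M \<mu>)"
    using F measurable_compose[of ?F "borel \<Otimes>\<^sub>M \<mu>" borel Re borel]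
    by (simp add: test_on_def borel_measurable_Re)
  then have [measurable]: "T (\<lambda>z. ennreal (f z)) \<in> borel_measurable (completion \<mu>)"
    by (intro T_measurable measurable_compose[OF _ measurable_ennreal])
  have [measurable]: "t \<in> borel_measurable (completion \<mu>)"
    unfolding t_def by measurable
  have "AE x in completion \<mu>. T (\<lambda>z. ennreal (f z)) x = ennreal (t x) \<and> complex_of_real (t x) = per ?F x"
    using AE_finite_hitting_uminus[OF K]
  proof eventually_elim
    case (elim x)
    then show ?case using per_nonneg[OF K F f, of x] by (auto simp: t_def)
  qed
  then have T_eq: "AE x in completion \<mu>. T (\<lambda>z. ennreal (f z)) x = ennreal (t x)"
    and per_eq: "AE x in completion \<mu>. complex_of_real (t x) = per ?F x"
    by auto
  have t0: "0 \<le> t x" for x by (simp add: t_def)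
  have "integrable \<nu> f"
    using integrable_test_on[OF K F] by (simp add: complex_of_real_integrable_eq)
  then have \<nu>f: "(\<integral>\<^sup>+z. ennreal (f z) \<partial>\<nu>) = ennreal (\<integral>z. f z \<partial>\<nu>)"
    using f by (intro nn_integral_eq_integral) auto
  have "(\<integral>\<^sup>+x. ennreal (t x) \<partial>completion \<mu>) = (\<integral>\<^sup>+x. T (\<lambda>z. ennreal (f z)) x \<partial>completion \<mu>)"
    using T_eq by (intro nn_integral_cong_AE) auto
  also have "\<dots> = (\<integral>\<^sup>+z. ennreal (f z) \<partial>\<nu>)"
    using fm by (intro nn_integral_\<nu>[symmetric] measurable_compose[OF _ measurable_ennreal])
  finally have *: "(\<integral>\<^sup>+x. ennreal (t x) \<partial>completion \<mu>) = ennreal (\<integral>z. f z \<partial>\<nu>)"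
    unfolding \<nu>f .
  then have t_int: "integrable (completion \<mu>) t"
    using t0 by (intro integrableI_nonneg) auto
  have t_eq: "(\<integral>x. t x \<partial>completion \<mu>) = (\<integral>z. f z \<partial>\<nu>)"
    using * t0 f by (subst integral_eq_nn_integral) (auto simp: integral_nonneg_AE)
  \<comment> \<open>Measurability of the complex periodization is inherited from \<open>T\<close>:
    it agrees almost everywhere with \<open>t\<close>.\<close>
  have per_meas: "per ?F \<in> borel_measurable (completion \<mu>)"
    using per_eq by (rule borel_measurable_completion_AE[rotated]) measurable
  have "integrable (completion \<mu>) (\<lambda>x. complex_of_real (t x))"
    using t_int by (simp add: complex_of_real_integrable_eq)
  then have "integrable (completion \<mu>) (per ?F)"
    using per_meas per_eq by (rule integrable_cong_AE_imp)
  moreover have "(\<integral>x. per ?F x \<partial>completion \<mu>) = (\<integral>x. complex_of_real (t x) \<partial>completion \<mu>)"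
    using per_meas per_eq by (intro integral_cong_AE) (auto elim!: eventually_mono)
  ultimately show ?thesis by (simp add: t_eq)
qed

text \<open>The three properties travel together through linear combinations: support for finiteness
  of the sums, integrability for linearity of the integral.\<close>

definition Campbell :: "'g set \<Rightarrow> ('g \<times> 'x \<Rightarrow> complex) \<Rightarrow> bool" where
  "Campbell K F \<longleftrightarrow> test_on K F \<and> integrable (completion \<mu>) (per F) \<and>
    (\<integral>x. per F x \<partial>completion \<mu>) = (\<integral>z. F z \<partial>\<nu>)"

text \<open>Additivity of the periodization holds only at points with finitely many relevant cosets,
  so the linear combination is compared with it almost everywhere.\<close>

lemma Campbell_lincomb:
  assumes K: "compact K" and F: "Campbell K F" and G: "Campbell K G"
  shows "Campbell K (\<lambda>z. a * F z + b * G z)"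
proof -
  let ?L = "\<lambda>z. a * F z + b * G z"
  have test: "test_on K F" "test_on K G" using F G by (simp_all add: Campbell_def)
  have ae: "AE x in completion \<mu>. a * per F x + b * per G x = per ?L x"
    using AE_finite_hitting_uminus[OF K]
  proof eventually_elim
    case (elim x)
    then show ?case using per_lincomb[OF K test, of x a b] by simp
  qed
  have int: "integrable (completion \<mu>) (per F)" "integrable (completion \<mu>) (per G)"
    using F G by (simp_all add: Campbell_def)
  then have int_L: "integrable (completion \<mu>) (\<lambda>x. a * per F x + b * per G x)" by simp
  then have meas: "per ?L \<in> borel_measurable (completion \<mu>)"
    using ae by (intro borel_measurable_completion_AE[OF borel_measurable_integrable])
  have "integrable (completion \<mu>) (per ?L)"
    using int_L meas ae by (rule integrable_cong_AE_imp)
  moreover have "(\<integral>x. per ?L x \<partial>completion \<mu>) = (\<integral>x. a * per F x + b * per G x \<partial>completion \<mu>)"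
    using meas ae borel_measurable_integrable[OF int_L]
    by (intro integral_cong_AE) (auto elim!: eventually_mono)
  ultimately show ?thesis
    using F G int integrable_test_on[OF K test(1)] integrable_test_on[OF K test(2)] test_on_lincomb[OF test]
    by (simp add: Campbell_def)
qed

lemma Campbell_test_on:
  assumes K: "compact K" and F: "test_on K F"
  shows "Campbell K F"
proof -
  \<comment> \<open>Used for \<open>u\<close> equal to plus or minus the real or imaginary part. The
    bound by the norm preserves boundedness and forces \<open>u 0 = 0\<close>, so the support over
    \<open>K\<close> is preserved too.\<close>
  have pos: "Campbell K (\<lambda>z. complex_of_real (max 0 (u (F z))))"
    if u: "u \<in> borel_measurable borel" "\<And>w. \<bar>u w\<bar> \<le> norm w" for u :: "complex \<Rightarrow> real"
  proof -
    have le: "norm (complex_of_real (max 0 (u w))) \<le> norm w" for w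
      unfolding norm_of_real using u(2)[of w] by simp
    have "test_on K (\<lambda>z. complex_of_real (max 0 (u (F z))))"
      unfolding test_on_def
    proof (intro conjI)
      have [measurable]: "F \<in> borel_measurable (borel \<Otimes>\<^sub>M \<mu>)" using F by (simp add: test_on_def)
      note [measurable] = u(1)
      show "(\<lambda>z. complex_of_real (max 0 (u (F z)))) \<in> borel_measurable (borel \<Otimes>\<^sub>M \<mu>)" by measurable
      obtain c where "\<forall>g. \<forall>x\<in>space X. norm (F (g, x)) \<le> c"
        using F by (auto simp: test_on_def)
      then show "\<exists>c. \<forall>g. \<forall>x\<in>space X. norm (complex_of_real (max 0 (u (F (g, x))))) \<le> c"
        using le order_trans by blast
      have "u 0 = 0" using u(2)[of 0] by simp
      then show "\<forall>g. \<forall>x\<in>space X. g \<notin> K \<longrightarrow> complex_of_real (max 0 (u (F (g, x)))) = 0"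
        using F by (auto simp: test_on_def)
    qed
    then show ?thesis
      unfolding Campbell_def using Campbell_nonneg[OF K, of "\<lambda>z. max 0 (u (F z))"] by simp
  qed
  have re: "Campbell K (\<lambda>z. 1 * complex_of_real (max 0 (Re (F z))) + (- 1) * complex_of_real (max 0 (- Re (F z))))"
    by (intro Campbell_lincomb K pos) (auto simp: abs_Re_le_cmod)
  have im: "Campbell K (\<lambda>z. 1 * complex_of_real (max 0 (Im (F z))) + (- 1) * complex_of_real (max 0 (- Im (F z))))"
    by (intro Campbell_lincomb K pos) (auto simp: abs_Im_le_cmod)
  have "F = (\<lambda>z. 1 * (1 * complex_of_real (max 0 (Re (F z))) + (- 1) * complex_of_real (max 0 (- Re (F z)))) +
      \<i> * (1 * complex_of_real (max 0 (Im (F z))) + (- 1) * complex_of_real (max 0 (- Im (F z)))))"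
    by (intro ext complex_eqI) (auto simp: max_def)
  then show ?thesis
    using Campbell_lincomb[OF K re im, of 1 \<i>] by simp
qed

text \<open>Every point at which the second argument is evaluated has the form
  \<open>(h + g).x\<close> with \<open>Hg\<close> in the hitting set and therefore lies in
  \<open>Y\<close>. Test functions may thus be extended by zero.\<close>

lemma per_cong_Y:
  assumes "\<And>g y. y \<in> Y \<Longrightarrow> F (g, y) = F' (g, y)" "x \<in> space X"
  shows "per F x = per F' x"
  unfolding per_eq orbit_def
  using assms hitting_rep(2)[OF _ assms(2)]
  by (intro infsum_cong Bochner_Integration.integral_cong refl) (auto simp: space_mH)

text \<open>At the points of evaluation the first argument is the inverse of the element that moved
  \<open>x\<close>, so it carries the second argument back to \<open>x\<close> and the factor is the
  constant \<open>k x\<close>. A constant factor leaves the integral and the sum even where these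
  have their default value.\<close>

lemma per_mult_invariant:
  assumes x: "x \<in> space X"
  shows "per (\<lambda>z. F z * k (act (fst z) (snd z))) x = per F x * k x"
proof -
  have "orbit (\<lambda>z. F z * k (act (fst z) (snd z))) (g, x) = (\<lambda>h. orbit F (g, x) h * k x)" for g
    using x by (simp add: orbit_def act_uminus)
  then show ?thesis by (simp add: per_eq infsum_cmult_left')
qed

text \<open>The function \<phi> is absorbed into the test function as a factor depending on
  \<open>g.y\<close>; it is bounded, so boundedness and compact support over \<open>G\<close>
  survive.\<close>

lemma Linf_c_test_on:
  assumes F: "F \<in> Linf_c X Y" and \<phi>: "\<phi> \<in> Linf X"
  obtains K where "compact K"
    "test_on K (\<lambda>z. (indicator (UNIV \<times> Y) z *\<^sub>R F z) * cnj (\<phi> (act (fst z) (snd z))))"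
proof -
  obtain K where K: "compact K" "\<forall>g y. g \<notin> K \<and> y \<in> Y \<longrightarrow> F (g, y) = 0"
    using F unfolding Linf_c_def by blast
  obtain c where c: "\<forall>g. \<forall>y\<in>Y. norm (F (g, y)) \<le> c"
    using F unfolding Linf_c_def by blast
  obtain d where d: "\<forall>x\<in>space X. norm (\<phi> x) \<le> d"
    using \<phi> unfolding Linf_def by blast
  have "test_on K (\<lambda>z. (indicator (UNIV \<times> Y) z *\<^sub>R F z) * cnj (\<phi> (act (fst z) (snd z))))"
    unfolding test_on_def
  proof (intro conjI)
    have "(\<lambda>z. indicator (UNIV \<times> Y) z *\<^sub>R F z) \<in> borel_measurable (borel \<Otimes>\<^sub>M X)"
      using F by (intro borel_measurable_extend_snd Y_sets) (simp add: Linf_c_def)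
    then have 1: "(\<lambda>z. indicator (UNIV \<times> Y) z *\<^sub>R F z) \<in> borel_measurable (borel \<Otimes>\<^sub>M \<mu>)"
      by (simp add: sets_\<mu> cong: measurable_cong_sets sets_pair_measure_cong)
    have [measurable]: "\<phi> \<in> borel_measurable X" using \<phi> by (simp add: Linf_def)
    have "(\<lambda>z. \<phi> (act (fst z) (snd z))) \<in> borel_measurable (borel \<Otimes>\<^sub>M \<mu>)" by measurable
    then have "(\<lambda>z. cnj (\<phi> (act (fst z) (snd z)))) \<in> borel_measurable (borel \<Otimes>\<^sub>M \<mu>)"
      by (rule measurable_compose[OF _ borel_measurable_continuous_onI]) (intro continuous_intros)
    with 1 show "(\<lambda>z. (indicator (UNIV \<times> Y) z *\<^sub>R F z) * cnj (\<phi> (act (fst z) (snd z)))) \<in> borel_measurable (borel \<Otimes>\<^sub>M \<mu>)"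
      by (rule borel_measurable_times)
    have "norm ((indicator (UNIV \<times> Y) (g, x) *\<^sub>R F (g, x)) * cnj (\<phi> (act g x))) \<le> max 0 c * max 0 d"
      if "x \<in> space X" for g x
    proof -
      have "norm (indicator (UNIV \<times> Y) (g, x) *\<^sub>R F (g, x)) \<le> max 0 c"
        using c by (auto simp: indicator_def intro: le_max_iff_disj[THEN iffD2])
      moreover have "norm (cnj (\<phi> (act g x))) \<le> max 0 d"
        using d act_space[OF that, of g] by (auto intro: le_max_iff_disj[THEN iffD2])
      ultimately show ?thesis
        unfolding norm_mult by (intro mult_mono) auto
    qed
    then show "\<exists>c. \<forall>g. \<forall>x\<in>space X. norm ((indicator (UNIV \<times> Y) (g, x) *\<^sub>R F (g, x)) *
        cnj (\<phi> (act (fst (g, x)) (snd (g, x))))) \<le> c"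
      by auto
    show "\<forall>g. \<forall>x\<in>space X. g \<notin> K \<longrightarrow>
        (indicator (UNIV \<times> Y) (g, x) *\<^sub>R F (g, x)) * cnj (\<phi> (act (fst (g, x)) (snd (g, x)))) = 0"
      using K(2) by (auto simp: indicator_def)
  qed
  with K(1) show thesis by (rule that)
qed

lemma integrable_per:
  assumes F: "F \<in> Linf_c X Y"
  shows "integrable (completion \<mu>) (per F)"
proof -
  have "(\<lambda>_. 1) \<in> Linf X" by (auto simp: Linf_def)
  then obtain K where K: "compact K" "test_on K (\<lambda>z. indicator (UNIV \<times> Y) z *\<^sub>R F z)"
    using Linf_c_test_on[OF F, of "\<lambda>_. 1"] by auto
  have "integrable (completion \<mu>) (per (\<lambda>z. indicator (UNIV \<times> Y) z *\<^sub>R F z))"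
    using Campbell_test_on[OF K] by (simp add: Campbell_def)
  moreover have "integrable (completion \<mu>) (per (\<lambda>z. indicator (UNIV \<times> Y) z *\<^sub>R F z)) \<longleftrightarrow>
      integrable (completion \<mu>) (per F)"
    by (intro Bochner_Integration.integrable_cong refl per_cong_Y) (auto simp: space_\<mu>)
  ultimately show ?thesis by blast
qed

lemma integral_per_disintegrate:
  assumes \<sigma>: "sets \<sigma> = sets \<mu>" "finite_measure \<sigma>" "mG \<Otimes>\<^sub>M \<sigma> = \<nu>"
    and F: "F \<in> Linf_c X Y" and \<phi>: "\<phi> \<in> Linf X"
  shows "(\<integral>x. per F x * cnj (\<phi> x) \<partial>completion \<mu>) =
    (\<integral>g. (\<integral>y. F (g, y) * cnj (\<phi> (act g y)) \<partial>restrict_space \<sigma> Y) \<partial>mG)"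
proof -
  let ?F = "\<lambda>z. indicator (UNIV \<times> Y) z *\<^sub>R F z"
  let ?G = "\<lambda>z. ?F z * cnj (\<phi> (act (fst z) (snd z)))"
  obtain K where K: "compact K" "test_on K ?G"
    using Linf_c_test_on[OF F \<phi>] .
  interpret \<sigma>: finite_measure \<sigma> by fact
  interpret P: pair_sigma_finite mG \<sigma> by unfold_locales
  have "(\<integral>x. per F x * cnj (\<phi> x) \<partial>completion \<mu>) = (\<integral>x. per ?G x \<partial>completion \<mu>)"
  proof (intro Bochner_Integration.integral_cong refl)
    fix x assume "x \<in> space (completion \<mu>)"
    then have x: "x \<in> space X" by (simp add: space_\<mu>)
    have "per F x = per ?F x" using x by (intro per_cong_Y) auto
    then show "per F x * cnj (\<phi> x) = per ?G x"
      using per_mult_invariant[OF x, of ?F "\<lambda>x. cnj (\<phi> x)"] by simp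
  qed
  also have "\<dots> = (\<integral>z. ?G z \<partial>\<nu>)"
    using Campbell_test_on[OF K] by (simp add: Campbell_def)
  also have "\<dots> = (\<integral>g. (\<integral>y. ?G (g, y) \<partial>\<sigma>) \<partial>mG)"
    using P.integral_fst'[of ?G] integrable_test_on[OF K] by (simp add: \<sigma>(3))
  \<comment> \<open>The extension by zero off \<open>Y\<close> is exactly what turns the integral
    over \<open>\<sigma>\<close> into one over its restriction to \<open>Y\<close>.\<close>
  also have "\<dots> = (\<integral>g. (\<integral>y. F (g, y) * cnj (\<phi> (act g y)) \<partial>restrict_space \<sigma> Y) \<partial>mG)"
  proof (rule Bochner_Integration.integral_cong[OF refl])
    fix g
    have "Y \<inter> space \<sigma> \<in> sets \<sigma>" by (simp add: \<sigma>(1) sets_\<mu>)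
    then show "(\<integral>y. ?G (g, y) \<partial>\<sigma>) = (\<integral>y. F (g, y) * cnj (\<phi> (act g y)) \<partial>restrict_space \<sigma> Y)"
      by (simp add: integral_restrict_space indicator_def)
  qed
  finally show ?thesis .
qed

text \<open>The translation formula for \<nu> compares the rectangle over \<open>K + h\<close> and
  the preimage of \<open>A\<close> with \<open>K \<times> A\<close>. Right invariance of
  \<open>mG\<close> equates the two first factors, and \<open>mG K\<close>, being positive and
  finite, cancels.\<close>

lemma restricted_invariant:
  assumes \<sigma>: "sets \<sigma> = sets \<mu>" "finite_measure \<sigma>" "mG \<Otimes>\<^sub>M \<sigma> = \<nu>" and h: "h \<in> H"
  shows "distr (restrict_space \<sigma> Y) (restrict_space \<sigma> Y) (act h) = restrict_space \<sigma> Y"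
proof -
  interpret \<sigma>: finite_measure \<sigma> by fact
  obtain K where K: "compact K" "0 < emeasure mG K" "emeasure mG K < \<infinity>"
    using haar_measure_compact_pos[OF lc haar_G] .
  have K_borel: "K \<in> sets borel" by (intro borel_closed compact_imp_closed K(1))
  have space_\<sigma>: "space \<sigma> = space X"
    using sets_eq_imp_space_eq[OF \<sigma>(1)] by (simp add: space_\<mu>)
  have Y\<sigma>: "Y \<inter> space \<sigma> \<in> sets \<sigma>" by (simp add: \<sigma>(1) sets_\<mu>)
  have rect: "emeasure \<nu> (E \<times> A) = emeasure mG E * emeasure \<sigma> A"
    if "E \<in> sets borel" "A \<in> sets \<mu>" for E A
    unfolding \<sigma>(3)[symmetric] using that by (intro \<sigma>.emeasure_pair_measure_Times) (simp_all add: sets_mG \<sigma>(1))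
  have act_h [measurable]: "act h \<in> \<mu> \<rightarrow>\<^sub>M \<mu>" by measurable
  have inv: "emeasure \<sigma> (act h -` A \<inter> space X) = emeasure \<sigma> A" if A: "A \<in> sets \<mu>" for A
  proof -
    have "(\<lambda>g. g + - h) \<in> mG \<rightarrow>\<^sub>M mG" by measurable
    then have "emeasure mG ((\<lambda>g. g + - h) -` K) = emeasure mG K"
      using arg_cong[OF mG_right[of "- h"], of "\<lambda>M. emeasure M K"] K_borel
      by (simp add: emeasure_distr sets_mG space_mG)
    moreover have "(\<lambda>g. g + - h) -` K \<in> sets borel"
      using measurable_sets[OF \<open>(\<lambda>g. g + - h) \<in> mG \<rightarrow>\<^sub>M mG\<close>, of K] K_borel by (simp add: sets_mG space_mG)
    moreover have "act h -` A \<inter> space \<mu> \<in> sets \<mu>"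
      using act_h A by (rule measurable_sets)
    ultimately have "emeasure mG K * emeasure \<sigma> (act h -` A \<inter> space \<mu>) = emeasure mG K * emeasure \<sigma> A"
      using \<nu>_H_translate[OF K_borel A h] K_borel A by (simp add: rect)
    then show ?thesis
      using K(2,3) by (auto simp: ennreal_mult_cancel_left space_\<mu>)
  qed
  show ?thesis
  proof (rule measure_eqI)
    fix A assume "A \<in> sets (distr (restrict_space \<sigma> Y) (restrict_space \<sigma> Y) (act h))"
    then have A: "A \<in> sets \<mu>" "A \<subseteq> Y"
      using Y\<sigma> by (auto simp: sets_restrict_space_iff \<sigma>(1))
    have "act h \<in> restrict_space \<sigma> Y \<rightarrow>\<^sub>M restrict_space \<sigma> Y"
      using H_act_Y[OF h] measurable_cong_sets[OF \<sigma>(1) \<sigma>(1)] act_h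
      by (intro measurable_restrict_space3) auto
    \<comment> \<open>The inverse of \<open>h\<close> also maps \<open>Y\<close> into itself, so a
      point carried by \<open>h\<close> into a subset of \<open>Y\<close> was already in
      \<open>Y\<close>; invariance on \<open>X\<close> therefore restricts to
      \<open>Y\<close>.\<close>
    moreover have "act h -` A \<inter> Y = act h -` A \<inter> space X"
    proof (intro equalityI subsetI)
      fix x assume "x \<in> act h -` A \<inter> space X"
      then have "act h x \<in> Y" "x \<in> space X" using A(2) by auto
      then have "x \<in> Y" using H_act_Y[OF H_uminus[OF h], of "act h x"] by (simp add: act_uminus)
      with \<open>x \<in> act h -` A \<inter> space X\<close> show "x \<in> act h -` A \<inter> Y" by blast
    qed (auto simp: Y_space)
    moreover have "space (restrict_space \<sigma> Y) = Y"
      using Y_space by (auto simp: space_restrict_space space_\<sigma>)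
    ultimately show "emeasure (distr (restrict_space \<sigma> Y) (restrict_space \<sigma> Y) (act h)) A =
        emeasure (restrict_space \<sigma> Y) A"
      using A Y\<sigma> inv[OF A(1)] Int_lower2[of "act h -` A" Y]
      by (simp add: emeasure_distr emeasure_restrict_space sets_restrict_space_iff \<sigma>(1))
  qed simp
qed

text \<open>The indicators of \<open>K \<times> A\<close> are admissible test functions, and their
  iterated integral is \<open>measure mG K\<close> times the measure of \<open>A\<close>; the first
  factor is nonzero and cancels.\<close>

lemma transverse_measure_unique:
  assumes \<sigma>: "sets \<sigma> = sets (restrict_space X Y)" "finite_measure \<sigma>"
    and \<tau>: "sets \<tau> = sets (restrict_space X Y)" "finite_measure \<tau>"
    and eq: "\<And>F. F \<in> Linf_c X Y \<Longrightarrow>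
      (\<integral>g. (\<integral>y. F (g, y) \<partial>\<sigma>) \<partial>mG) = (\<integral>g. (\<integral>y. F (g, y) \<partial>\<tau>) \<partial>mG)"
  shows "\<sigma> = \<tau>"
proof (rule measure_eqI)
  interpret \<sigma>: finite_measure \<sigma> by fact
  interpret \<tau>: finite_measure \<tau> by fact
  obtain K where K: "compact K" "0 < emeasure mG K" "emeasure mG K < \<infinity>"
    using haar_measure_compact_pos[OF lc haar_G] .
  have K_borel: "K \<in> sets borel" by (intro borel_closed compact_imp_closed K(1))
  fix A assume "A \<in> sets \<sigma>"
  then have A: "A \<in> sets (restrict_space X Y)" by (simp add: \<sigma>(1))
  define F where "F = (indicator (K \<times> A) :: 'g \<times> 'x \<Rightarrow> complex)"
  have "F \<in> Linf_c X Y"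
    unfolding Linf_c_def F_def using K(1) K_borel A
    by (auto intro!: borel_measurable_indicator pair_measureI exI[of _ 1] exI[of _ K] simp: indicator_def)
  have rect: "(\<integral>g. (\<integral>y. F (g, y) \<partial>\<rho>) \<partial>mG) = complex_of_real (measure mG K * measure \<rho> A)"
    if "A \<in> sets \<rho>" for \<rho>
  proof -
    have ind: "(\<integral>y. indicator B y \<partial>M) = complex_of_real (measure M B)" if "B \<in> sets M" for B and M :: "'b measure"
    proof -
      have "(\<integral>y. indicator B y \<partial>M) = (\<integral>y. complex_of_real (indicator B y) \<partial>M)"
        by (intro Bochner_Integration.integral_cong) (auto simp: indicator_def)
      also have "\<dots> = complex_of_real (\<integral>y. indicator B y \<partial>M)"
        by (rule integral_complex_of_real)
      also have "(\<integral>y. indicator B y \<partial>M) = measure M B"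
        using that by simp
      finally show ?thesis .
    qed
    have "(\<integral>y. F (g, y) \<partial>\<rho>) = indicator K g * complex_of_real (measure \<rho> A)" for g
      using ind[OF that] by (simp add: F_def indicator_times)
    then show ?thesis
      using ind[of K mG] K_borel by (simp add: sets_mG)
  qed
  have "complex_of_real (measure mG K * measure \<sigma> A) = complex_of_real (measure mG K * measure \<tau> A)"
    using eq[OF \<open>F \<in> Linf_c X Y\<close>] A by (simp only: rect \<sigma>(1) \<tau>(1))
  moreover have "measure mG K \<noteq> 0"
    using K(2,3) by (auto simp: measure_def enn2real_eq_0_iff)
  ultimately have "measure \<sigma> A = measure \<tau> A"
    by (metis mult_left_cancel of_real_eq_iff)
  then show "emeasure \<sigma> A = emeasure \<tau> A"
    by (simp add: \<sigma>.emeasure_eq_measure \<tau>.emeasure_eq_measure)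
qed (simp add: \<sigma>(1) \<tau>(1))

lemma transverse_measure_ex1:
  "\<exists>!\<sigma>. sets \<sigma> = sets (restrict_space X Y) \<and> finite_measure \<sigma> \<and>
     (\<forall>h\<in>H. distr \<sigma> \<sigma> (act h) = \<sigma>) \<and>
     (\<forall>F\<in>Linf_c X Y. \<forall>\<phi>\<in>Linf X.
        (\<integral>x. per F x * cnj (\<phi> x) \<partial>completion \<mu>) =
        (\<integral>g. (\<integral>y. F (g, y) * cnj (\<phi> (act g y)) \<partial>\<sigma>) \<partial>mG))"
proof -
  obtain \<sigma> where \<sigma>: "sets \<sigma> = sets \<mu>" "finite_measure \<sigma>" "mG \<Otimes>\<^sub>M \<sigma> = \<nu>"
    using disintegration .
  \<comment> \<open>Uniqueness is tested with \<phi> equal to 1: the left-hand side does not involve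
    the transverse measure, so two solutions have equal iterated integrals.\<close>
  have one: "(\<lambda>_. 1) \<in> Linf X" by (auto simp: Linf_def)
  show ?thesis
  proof (rule ex1I[of _ "restrict_space \<sigma> Y"], intro conjI ballI)
    show sets: "sets (restrict_space \<sigma> Y) = sets (restrict_space X Y)"
      by (simp add: sets_restrict_space \<sigma>(1) sets_\<mu>)
    show fin: "finite_measure (restrict_space \<sigma> Y)"
      using \<sigma>(1,2) by (intro finite_measure_restrict_space) (simp_all add: sets_\<mu>)
    show "distr (restrict_space \<sigma> Y) (restrict_space \<sigma> Y) (act h) = restrict_space \<sigma> Y" if "h \<in> H" for h
      by (rule restricted_invariant[OF \<sigma> that])
    show eq: "(\<integral>x. per F x * cnj (\<phi> x) \<partial>completion \<mu>) =
        (\<integral>g. (\<integral>y. F (g, y) * cnj (\<phi> (act g y)) \<partial>restrict_space \<sigma> Y) \<partial>mG)"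
      if "F \<in> Linf_c X Y" "\<phi> \<in> Linf X" for F \<phi>
      by (rule integral_per_disintegrate[OF \<sigma> that])
    fix \<tau>
    assume \<tau>: "sets \<tau> = sets (restrict_space X Y) \<and> finite_measure \<tau> \<and>
     (\<forall>h\<in>H. distr \<tau> \<tau> (act h) = \<tau>) \<and>
     (\<forall>F\<in>Linf_c X Y. \<forall>\<phi>\<in>Linf X.
        (\<integral>x. per F x * cnj (\<phi> x) \<partial>completion \<mu>) =
        (\<integral>g. (\<integral>y. F (g, y) * cnj (\<phi> (act g y)) \<partial>\<tau>) \<partial>mG))"
    show "\<tau> = restrict_space \<sigma> Y"
    proof (rule transverse_measure_unique)
      fix F :: "'g \<times> 'x \<Rightarrow> complex" assume F: "F \<in> Linf_c X Y"
      show "(\<integral>g. (\<integral>y. F (g, y) \<partial>\<tau>) \<partial>mG) = (\<integral>g. (\<integral>y. F (g, y) \<partial>restrict_space \<sigma> Y) \<partial>mG)"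
        using \<tau> eq[OF F one] F one by fastforce
    qed (use \<tau> sets fin in auto)
  qed
qed

end

theorem proposition1:
  fixes H :: "'g::{topological_group_add, second_countable_topology, t2_space} set"
    and mG mH :: "'g measure"
    and X \<mu> :: "'x measure"
    and act :: "'g \<Rightarrow> 'x \<Rightarrow> 'x"
    and Y :: "'x set"
  assumes "locally_compact_space (euclidean :: 'g topology)"
    and "unimodular (UNIV :: 'g set)"
    and "add_subgroup H" and "closed H" and "unimodular H"
    and "haar_measure UNIV mG" and "haar_measure H mH"
    and "integrable_transverse_system H X act Y \<mu>"
  shows "(\<forall>F\<in>Linf_c X Y. integrable (completion \<mu>) (periodization H mH act Y F)) \<and>
    (\<exists>!\<sigma>. sets \<sigma> = sets (restrict_space X Y) \<and> finite_measure \<sigma> \<and>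
       (\<forall>h\<in>H. distr \<sigma> \<sigma> (act h) = \<sigma>) \<and>
       (\<forall>F\<in>Linf_c X Y. \<forall>\<phi>\<in>Linf X.
          (\<integral>x. periodization H mH act Y F x * cnj (\<phi> x) \<partial>completion \<mu>) =
          (\<integral>g. (\<integral>y. F (g, y) * cnj (\<phi> (act g y)) \<partial>\<sigma>) \<partial>mG)))"
proof -
  interpret transverse H mG mH X \<mu> act Y
    using assms by (rule transverse.intro)
  show ?thesis
    using integrable_per transverse_measure_ex1 by blast
qed

end
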